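(* Let $L\in C^1([a,b]\times\mathbb{R}^{2N};\mathbb{R})$, $\mathbf{y}^a,\mathbf{y}^b\in\mathbb{R}^N$ with $\mathbf{y}^b=(y_1^b,\ldots,y_N^b)$, and $l\in\{1,\ldots,N\}$. Let $\mathbf{y}$ be a local minimizer of $\mathcal{J}(\mathbf{y})=\int_a^bL[\mathbf{y}]^{\alpha,\beta}_{\gamma}(x)\,dx$ over all $\mathbf{y}\in\mathbf{D}$ satisfying $\mathbf{y}(a)=\mathbf{y}^a$, $y_i(b)=y_i^b$ for $i=1,\ldots,N$, $i\neq l$, and $y_l(b)\le y_l^b$. Put $$\Lambda:=\Bigl[\gamma_l\,{}_xI_b^{1-\alpha_l}\,\partial_{N+l+1}L[\mathbf{y}]^{\alpha,\beta}_{\gamma}(x)-(1-\gamma_l)\,{}_aI_x^{1-\beta_l}\,\partial_{N+l+1}L[\mathbf{y}]^{\alpha,\beta}_{\gamma}(x)\Bigr]\Big|_{x=b}.$$ Then the following transversality condition holds: $$\Lambda\le 0,\qquad y_l(b)\le y_l^b,\qquad (y_l(b)-y_l^b)\,\Lambda=0.$$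
   Context: Let $a<b$, $N\in\mathbb{N}$, and $\alpha,\beta,\gamma\in\mathbb{R}^N$ with $\alpha_i,\beta_i\in(0,1)$, $\gamma_i\in[0,1]$. For scalar $\alpha\in(0,1)$, the left and right Riemann--Liouville fractional integrals are ${}_aI_x^{\alpha}f(x)=\frac{1}{\Gamma(\alpha)}\int_a^x(x-t)^{\alpha-1}f(t)\,dt$ and ${}_xI_b^{\alpha}f(x)=\frac{1}{\Gamma(\alpha)}\int_x^b(t-x)^{\alpha-1}f(t)\,dt$. For $f\in AC([a,b])$ (absolutely continuous), the left and right Caputo derivatives are ${}^C_aD_x^{\alpha}f={}_aI_x^{1-\alpha}f'$ and ${}^C_xD_b^{\alpha}f=-\,{}_xI_b^{1-\alpha}f'$. For scalars $\alpha,\beta\in(0,1)$, $\gamma\in[0,1]$ the combined Caputo derivative is ${}^CD^{\alpha,\beta}_{\gamma}=\gamma\,{}^C_aD_x^{\alpha}+(1-\gamma)\,{}^C_xD_b^{\beta}$. For vector parameters and $\mathbf{y}=(y_1,\ldots,y_N)$, ${}^CD^{\alpha,\beta}_{\gamma}\mathbf{y}=[{}^CD^{\alpha_1,\beta_1}_{\gamma_1}y_1,\ldots,{}^CD^{\alpha_N,\beta_N}_{\gamma_N}y_N]$. $\mathbf{D}$ is the set of $\mathbf{y}:[a,b]\to\mathbb{R}^N$ with components in $AC([a,b])$ such that ${}^CD^{\alpha,\beta}_{\gamma}\mathbf{y}$ exists and is continuous on $[a,b]$, with norm $\|\mathbf{y}\|_{1,\infty}=\max_{[a,b]}\|\mathbf{y}(x)\|+\max_{[a,b]}\|{}^CD^{\alpha,\beta}_{\gamma}\mathbf{y}(x)\|$,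 where $\|\cdot\|$ is a norm on $\mathbb{R}^N$. $[\mathbf{y}]^{\alpha,\beta}_{\gamma}(x)=(x,\mathbf{y}(x),{}^CD^{\alpha,\beta}_{\gamma}\mathbf{y}(x))$, and $L[\mathbf{y}]^{\alpha,\beta}_{\gamma}(x)$ is $L$ evaluated at this point. $\partial_iK$ is the partial derivative of $K$ with respect to its $i$th argument (so $\partial_{N+l+1}L$ is with respect to the $l$th component of the fractional derivative). A local minimizer of $\mathcal{J}$ on an admissible set $\mathcal{D}\subset\mathbf{D}$ is $\bar{\mathbf{y}}\in\mathcal{D}$ for which there is $\delta>0$ with $\mathcal{J}(\bar{\mathbf{y}})\le\mathcal{J}(\mathbf{y})$ for all $\mathbf{y}\in\mathcal{D}$ with $\|\mathbf{y}-\bar{\mathbf{y}}\|_{1,\infty}<\delta$. *)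

theory Defs
  imports "HOL-Analysis.Analysis"
begin

definition abs_continuous_on :: "real \<Rightarrow> real \<Rightarrow> (real \<Rightarrow> real) \<Rightarrow> bool" where
  "abs_continuous_on a b f \<longleftrightarrow>
     (\<forall>\<epsilon>>0. \<exists>\<delta>>0. \<forall>I :: (real \<times> real) set.
        finite I \<and> (\<forall>(u, v)\<in>I. a \<le> u \<and> u \<le> v \<and> v \<le> b) \<and>
        disjoint_family_on (\<lambda>(u, v). {u<..<v}) I \<and>
        (\<Sum>(u, v)\<in>I. v - u) < \<delta> \<longrightarrow>
        (\<Sum>(u, v)\<in>I. \<bar>f v - f u\<bar>) < \<epsilon>)"

definition is_norm :: "('a::real_vector \<Rightarrow> real) \<Rightarrow> bool" where
  "is_norm \<nu> \<longleftrightarrow>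
     (\<forall>v. \<nu> v \<ge> 0) \<and> (\<forall>v. \<nu> v = 0 \<longleftrightarrow> v = 0) \<and>
     (\<forall>c v. \<nu> (c *\<^sub>R v) = \<bar>c\<bar> * \<nu> v) \<and> (\<forall>v w. \<nu> (v + w) \<le> \<nu> v + \<nu> w)"

text \<open>Derivatives are taken within \<open>S\<close>, hence one-sided in the first argument at the
  boundary of \<open>S = {a..b} \<times> UNIV\<close>.\<close>

definition C1_on :: "'a::real_normed_vector set \<Rightarrow> ('a \<Rightarrow> 'b::real_normed_vector) \<Rightarrow> bool" where
  "C1_on S f \<longleftrightarrow>
     (\<exists>f' :: 'a \<Rightarrow> 'a \<Rightarrow>\<^sub>L 'b.
        (\<forall>p\<in>S. (f has_derivative blinfun_apply (f' p)) (at p within S)) \<and> continuous_on S f')"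

text \<open>Integrals are Lebesgue integrals; as they are total functions, convergence of the
  defining integral is recorded in separate predicates.\<close>

definition RL_int_left :: "real \<Rightarrow> real \<Rightarrow> (real \<Rightarrow> real) \<Rightarrow> real \<Rightarrow> real" where
  "RL_int_left a \<alpha> f x = 1 / Gamma \<alpha> * (LINT t:{a..x}|lebesgue. (x - t) powr (\<alpha> - 1) * f t)"

definition RL_int_right :: "real \<Rightarrow> real \<Rightarrow> (real \<Rightarrow> real) \<Rightarrow> real \<Rightarrow> real" where
  "RL_int_right b \<alpha> f x = 1 / Gamma \<alpha> * (LINT t:{x..b}|lebesgue. (t - x) powr (\<alpha> - 1) * f t)"

definition RL_int_left_exists :: "real \<Rightarrow> real \<Rightarrow> (real \<Rightarrow> real) \<Rightarrow> real \<Rightarrow> bool" where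
  "RL_int_left_exists a \<alpha> f x \<longleftrightarrow>
     set_integrable lebesgue {a..x} (\<lambda>t. (x - t) powr (\<alpha> - 1) * f t)"

definition RL_int_right_exists :: "real \<Rightarrow> real \<Rightarrow> (real \<Rightarrow> real) \<Rightarrow> real \<Rightarrow> bool" where
  "RL_int_right_exists b \<alpha> f x \<longleftrightarrow>
     set_integrable lebesgue {x..b} (\<lambda>t. (t - x) powr (\<alpha> - 1) * f t)"

text \<open>For absolutely continuous \<open>f\<close> the derivative exists almost everywhere; the arbitrary
  value of \<^const>\<open>deriv\<close> on the remaining null set does not affect the integrals.\<close>

definition caputo_left :: "real \<Rightarrow> real \<Rightarrow> (real \<Rightarrow> real) \<Rightarrow> real \<Rightarrow> real" where
  "caputo_left a \<alpha> f x = RL_int_left a (1 - \<alpha>) (deriv f) x"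

definition caputo_right :: "real \<Rightarrow> real \<Rightarrow> (real \<Rightarrow> real) \<Rightarrow> real \<Rightarrow> real" where
  "caputo_right b \<alpha> f x = - RL_int_right b (1 - \<alpha>) (deriv f) x"

definition comb_caputo ::
    "real \<Rightarrow> real \<Rightarrow> real \<Rightarrow> real \<Rightarrow> real \<Rightarrow> (real \<Rightarrow> real) \<Rightarrow> real \<Rightarrow> real" where
  "comb_caputo a b \<alpha> \<beta> \<gamma> f x = \<gamma> * caputo_left a \<alpha> f x + (1 - \<gamma>) * caputo_right b \<beta> f x"

text \<open>A one-sided derivative that enters with coefficient \<open>0\<close> is not required to exist.\<close>

definition comb_caputo_exists ::
    "real \<Rightarrow> real \<Rightarrow> real \<Rightarrow> real \<Rightarrow> real \<Rightarrow> (real \<Rightarrow> real) \<Rightarrow> real \<Rightarrow> bool" where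
  "comb_caputo_exists a b \<alpha> \<beta> \<gamma> f x \<longleftrightarrow>
     (\<gamma> \<noteq> 0 \<longrightarrow> RL_int_left_exists a (1 - \<alpha>) (deriv f) x) \<and>
     (\<gamma> \<noteq> 1 \<longrightarrow> RL_int_right_exists b (1 - \<beta>) (deriv f) x)"

definition comb_caputo_vec ::
    "real \<Rightarrow> real \<Rightarrow> real^'n \<Rightarrow> real^'n \<Rightarrow> real^'n \<Rightarrow> (real \<Rightarrow> real^'n) \<Rightarrow> real \<Rightarrow> real^'n" where
  "comb_caputo_vec a b \<alpha> \<beta> \<gamma> y x =
     (\<chi> i. comb_caputo a b (\<alpha> $ i) (\<beta> $ i) (\<gamma> $ i) (\<lambda>t. y t $ i) x)"

definition D_space ::
    "real \<Rightarrow> real \<Rightarrow> real^'n \<Rightarrow> real^'n \<Rightarrow> real^'n \<Rightarrow> (real \<Rightarrow> real^'n) set" where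
  "D_space a b \<alpha> \<beta> \<gamma> =
     {y. (\<forall>i. abs_continuous_on a b (\<lambda>t. y t $ i)) \<and>
         (\<forall>i. \<forall>x\<in>{a..b}. comb_caputo_exists a b (\<alpha> $ i) (\<beta> $ i) (\<gamma> $ i) (\<lambda>t. y t $ i) x) \<and>
         continuous_on {a..b} (comb_caputo_vec a b \<alpha> \<beta> \<gamma> y)}"

text \<open>On \<open>D_space\<close> both suprema are attained, so they are the maxima.\<close>

definition norm_1_inf ::
    "(real^'n \<Rightarrow> real) \<Rightarrow> real \<Rightarrow> real \<Rightarrow> real^'n \<Rightarrow> real^'n \<Rightarrow> real^'n \<Rightarrow>
     (real \<Rightarrow> real^'n) \<Rightarrow> real" where
  "norm_1_inf \<nu> a b \<alpha> \<beta> \<gamma> y =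
     (SUP x\<in>{a..b}. \<nu> (y x)) + (SUP x\<in>{a..b}. \<nu> (comb_caputo_vec a b \<alpha> \<beta> \<gamma> y x))"

definition bracket ::
    "real \<Rightarrow> real \<Rightarrow> real^'n \<Rightarrow> real^'n \<Rightarrow> real^'n \<Rightarrow> (real \<Rightarrow> real^'n) \<Rightarrow> real \<Rightarrow>
     real \<times> (real^'n) \<times> (real^'n)" where
  "bracket a b \<alpha> \<beta> \<gamma> y x = (x, y x, comb_caputo_vec a b \<alpha> \<beta> \<gamma> y x)"

text \<open>With \<open>'n\<close> standing for the indices \<open>1, \<dots>, N\<close>, this is \<open>\<partial>\<^bsub>N+l+1\<^esub>\<close>: the first argument
  is the time variable, followed by \<open>N\<close> state and \<open>N\<close> fractional derivative components.\<close>

definition partial_frac ::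
    "'n::finite \<Rightarrow> (real \<times> (real^'n) \<times> (real^'n) \<Rightarrow> real) \<Rightarrow> real \<times> (real^'n) \<times> (real^'n) \<Rightarrow> real" where
  "partial_frac l L = (\<lambda>(x, y, v). deriv (\<lambda>s. L (x, y, \<chi> i. if i = l then s else v $ i)) (v $ l))"

definition J_functional ::
    "real \<Rightarrow> real \<Rightarrow> real^'n \<Rightarrow> real^'n \<Rightarrow> real^'n \<Rightarrow> (real \<times> (real^'n) \<times> (real^'n) \<Rightarrow> real) \<Rightarrow>
     (real \<Rightarrow> real^'n) \<Rightarrow> real" where
  "J_functional a b \<alpha> \<beta> \<gamma> L y = (LINT x:{a..b}|lebesgue. L (bracket a b \<alpha> \<beta> \<gamma> y x))"

definition local_minimizer ::
    "(real^'n \<Rightarrow> real) \<Rightarrow> real \<Rightarrow> real \<Rightarrow> real^'n \<Rightarrow> real^'n \<Rightarrow> real^'n \<Rightarrow>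
     ((real \<Rightarrow> real^'n) \<Rightarrow> real) \<Rightarrow> (real \<Rightarrow> real^'n) set \<Rightarrow> (real \<Rightarrow> real^'n) \<Rightarrow> bool" where
  "local_minimizer \<nu> a b \<alpha> \<beta> \<gamma> J \<D> y \<longleftrightarrow>
     y \<in> \<D> \<and>
     (\<exists>\<delta>>0. \<forall>z\<in>\<D>. norm_1_inf \<nu> a b \<alpha> \<beta> \<gamma> (\<lambda>x. z x - y x) < \<delta> \<longrightarrow> J y \<le> J z)"

end

(* The test functions are the ramps r_c(x) = max 0 (x - c) in the l-th component.  The combined
   Caputo derivative of r_c is an explicit continuous function, so y + e r_c is admissible for small
   e < 0, and for small e > 0 as well if y_l(b) < y_l^b.  Hence the first variation V(c) along r_c is
   nonpositive, respectively zero.  Divided by r_c(b) = b - c it tends to Lambda as c tends to b, by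
   dominated convergence.

   That deriv (y + e r_c) = deriv y + e deriv r_c almost everywhere rests on Lebesgue's theorem that an
   absolutely continuous f is differentiable almost everywhere.  If f had straddling difference quotients
   above q and below p < q, at arbitrarily small scales, on a set E of positive measure, then one covers
   almost all of E by disjoint intervals of slope below p, and inside those again by disjoint intervals
   of slope above q (Vitali).  The gaps between the two packings have small total length, so the total
   increments of f over both nearly agree, which is impossible. *)
theory Submission
  imports Defs
begin

section \<open>Packings by closed intervals\<close>

text \<open>At x = b the right integral in \<Lambda> runs over a single point and vanishes, so the
  claim concerns -(1 - \<gamma>_l) times the left integral of order 1 - \<beta>_l alone. Variations
  concentrated at b detect exactly this quantity, which replaces the Euler-Lagrange equation and
  fractional integration by parts. The ramp r_c and its left Caputo derivative live on [c, b], and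
  their contributions die even after division by b - c. The right Caputo derivative is nonlocal: it
  is spread over all of [a, b], and its quotient tends to minus the kernel (b - t)^(-\<beta>) /
  \<Gamma>(1 - \<beta>), the kernel of the left integral at b.

  The obstacle is \<open>deriv\<close>, a total function that is additive only where
  differentiability is known; this is why the theorem on absolutely continuous functions comes
  first. Straddling quotients are chosen there because one interval witnesses steepness for all of
  its inner points, so the exceptional sets are measurable at once, and continuity later recovers
  the ordinary derivative.\<close>

definition packing :: "real \<Rightarrow> real \<Rightarrow> (real \<times> real) set \<Rightarrow> bool" where
  "packing a b D \<longleftrightarrow> finite D \<and> (\<forall>(u, v)\<in>D. a \<le> u \<and> u < v \<and> v \<le> b) \<and>
     pairwise (\<lambda>I J. disjnt {fst I..snd I} {fst J..snd J}) D"

text \<open>At \<open>h = id\<close> this is the total length of the intervals, so an identity valid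
  for all \<open>h\<close> compares lengths and increments of \<open>f\<close> at once.\<close>

definition incr :: "(real \<Rightarrow> real) \<Rightarrow> (real \<times> real) set \<Rightarrow> real" where
  "incr h D = (\<Sum>(u, v)\<in>D. h v - h u)"

lemma packingD:
  assumes "packing a b D"
  shows "finite D" "(u, v) \<in> D \<Longrightarrow> a \<le> u \<and> u < v \<and> v \<le> b"
    "(u, v) \<in> D \<Longrightarrow> (u', v') \<in> D \<Longrightarrow> (u, v) \<noteq> (u', v') \<Longrightarrow> disjnt {u..v} {u'..v'}"
  using assms unfolding packing_def pairwise_def by fastforce+

lemma packing_subset: "packing a b D \<Longrightarrow> D' \<subseteq> D \<Longrightarrow> packing a b D'"
  unfolding packing_def by (auto intro: finite_subset pairwise_subset)

text \<open>Increments over \<open>D\<close> and over the gaps telescope to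
  \<open>h v - h u\<close>. The same \<open>G\<close> serves every \<open>h\<close>: its length is
  known from \<open>h = id\<close>, and absolute continuity then controls the increments of
  \<open>f\<close> over it.\<close>

lemma packing_gaps:
  assumes "packing u v D" "u \<le> v"
  shows "\<exists>G. finite G \<and> (\<forall>(x, y)\<in>G. u \<le> x \<and> x \<le> y \<and> y \<le> v) \<and>
           disjoint_family_on (\<lambda>(x, y). {x<..<y}) G \<and>
           (\<forall>h. incr h G = h v - h u - incr h D)"
  using assms
proof (induction "card D" arbitrary: D v)
  case 0
  then have "D = {}"
    using packingD(1) by fastforce
  then show ?case
    using \<open>u \<le> v\<close> by (intro exI[of _ "{(u, v)}"]) (auto simp: incr_def disjoint_family_on_def)
next
  case (Suc n)
  have fin: "finite D"
    using Suc.prems packingD by blast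
  \<comment> \<open>The interval with the largest left endpoint is split off. Disjointness of the
    closed intervals makes all others end before \<open>x0\<close>, so the induction hypothesis
    applies on [u, x0], and \<open>(y0, v)\<close> is the last gap, possibly degenerate.\<close>
  have "D \<noteq> {}" using Suc.hyps(2) by auto
  then have "Max (fst ` D) \<in> fst ` D"
    using fin by (intro Max_in) auto
  then obtain y0 where y0: "(Max (fst ` D), y0) \<in> D" by force
  define x0 where "x0 = Max (fst ` D)"
  have D0: "(x0, y0) \<in> D" using y0 by (simp add: x0_def)
  have xmax: "x \<le> x0" if "(x, y) \<in> D" for x y
    unfolding x0_def using that fin by (intro Max_ge) (auto intro: image_eqI[where x="(x,y)"])
  have xy0: "u \<le> x0" "x0 < y0" "y0 \<le> v"
    using packingD(2)[OF Suc.prems(1) D0] by auto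
  define D' where "D' = D - {(x0, y0)}"
  have less: "y < x0" if "(x, y) \<in> D'" for x y
  proof -
    have "(x, y) \<in> D" "(x, y) \<noteq> (x0, y0)" using that by (auto simp: D'_def)
    then have "disjnt {x..y} {x0..y0}" using packingD(3)[OF Suc.prems(1)] D0 by blast
    moreover have "x \<le> x0" "x < y" using xmax packingD(2)[OF Suc.prems(1)] \<open>(x, y) \<in> D\<close> by auto
    ultimately show ?thesis using xy0 by (force simp: disjnt_iff)
  qed
  have "packing u v D'"
    using packing_subset[OF Suc.prems(1)] by (simp add: D'_def)
  then have "packing u x0 D'"
    using less by (fastforce simp: packing_def)
  moreover have "n = card D'"
    using Suc.hyps(2) D0 fin by (simp add: D'_def)
  ultimately obtain G where G: "finite G" "\<forall>(x, y)\<in>G. u \<le> x \<and> x \<le> y \<and> y \<le> x0"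
      "disjoint_family_on (\<lambda>(x, y). {x<..<y}) G" "\<And>h. incr h G = h x0 - h u - incr h D'"
    using Suc.hyps(1)[of D' x0] xy0 by blast
  have notin: "(y0, v) \<notin> G" using G(2) xy0 by force
  have "incr h (insert (y0, v) G) = h v - h u - incr h D" for h
  proof -
    have "incr h D = (h y0 - h x0) + incr h D'"
      unfolding incr_def D'_def using fin D0 by (subst sum.remove[of _ "(x0, y0)"]) auto
    moreover have "incr h (insert (y0, v) G) = (h v - h y0) + incr h G"
      unfolding incr_def using G(1) notin by simp
    ultimately show ?thesis using G(4) by simp
  qed
  moreover have "disjoint_family_on (\<lambda>(x, y). {x<..<y}) (insert (y0, v) G)"
    using G(2,3) xy0 notin unfolding disjoint_family_on_def by fastforce
  ultimately show ?case
    using G xy0 by (intro exI[of _ "insert (y0, v) G"]) fastforce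
qed

text \<open>Absolute continuity is applied to the gaps that \<open>D2\<close> leaves inside the
  intervals of \<open>D1\<close>: their total length is \<open>incr id D1 - incr id D2\<close>, and
  the increments of \<open>f\<close> over them add up to
  \<open>incr f D1 - incr f D2\<close>.\<close>

lemma abs_continuous_on_packing:
  assumes "abs_continuous_on a b f" "0 < \<eta>"
  obtains \<delta> where "\<delta> > 0"
    "\<And>D1 D2. packing a b D1 \<Longrightarrow> packing a b D2 \<Longrightarrow>
       (\<And>x y. (x, y) \<in> D2 \<Longrightarrow> \<exists>(u, v)\<in>D1. u \<le> x \<and> y \<le> v) \<Longrightarrow>
       incr id D1 - incr id D2 < \<delta> \<Longrightarrow> \<bar>incr f D1 - incr f D2\<bar> < \<eta>"
proof -
  obtain \<delta> where \<delta>: "\<delta> > 0" and ac: "\<And>I. finite I \<Longrightarrow> (\<forall>(u, v)\<in>I. a \<le> u \<and> u \<le> v \<and> v \<le> b) \<Longrightarrow>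
        disjoint_family_on (\<lambda>(u, v). {u<..<v}) I \<Longrightarrow>
        (\<Sum>(u, v)\<in>I. v - u) < \<delta> \<Longrightarrow> (\<Sum>(u, v)\<in>I. \<bar>f v - f u\<bar>) < \<eta>"
    using assms(1)[unfolded abs_continuous_on_def, rule_format, OF assms(2)] by blast
  have "\<bar>incr f D1 - incr f D2\<bar> < \<eta>"
    if D1: "packing a b D1" and D2: "packing a b D2"
      and sub: "\<And>x y. (x, y) \<in> D2 \<Longrightarrow> \<exists>(u, v)\<in>D1. u \<le> x \<and> y \<le> v"
      and less: "incr id D1 - incr id D2 < \<delta>" for D1 D2
  proof -
    define S where "S I = {J \<in> D2. fst I \<le> fst J \<and> snd J \<le> snd I}" for I :: "real \<times> real"
    have "\<exists>G. finite G \<and> (\<forall>(x, y)\<in>G. fst I \<le> x \<and> x \<le> y \<and> y \<le> snd I) \<and>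
           disjoint_family_on (\<lambda>(x, y). {x<..<y}) G \<and>
           (\<forall>h. incr h G = h (snd I) - h (fst I) - incr h (S I))" if "I \<in> D1" for I
    proof (rule packing_gaps)
      have "packing a b (S I)" by (rule packing_subset[OF D2]) (auto simp: S_def)
      then show "packing (fst I) (snd I) (S I)" by (fastforce simp: packing_def S_def)
      show "fst I \<le> snd I" using packingD(2)[OF D1, of "fst I" "snd I"] that by simp
    qed
    then obtain G where G: "\<And>I. I \<in> D1 \<Longrightarrow> finite (G I)"
        "\<And>I x y. I \<in> D1 \<Longrightarrow> (x, y) \<in> G I \<Longrightarrow> fst I \<le> x \<and> x \<le> y \<and> y \<le> snd I"
        "\<And>I. I \<in> D1 \<Longrightarrow> disjoint_family_on (\<lambda>(x, y). {x<..<y}) (G I)"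
        "\<And>I h. I \<in> D1 \<Longrightarrow> incr h (G I) = h (snd I) - h (fst I) - incr h (S I)"
      by (metis (no_types, lifting) case_prodD)
    have fin: "finite D1" "finite D2" using D1 D2 packingD(1) by auto
    have disj1: "disjnt {fst I..snd I} {fst J..snd J}" if "I \<in> D1" "J \<in> D1" "I \<noteq> J" for I J
      using D1 that by (auto simp: packing_def pairwise_def)
    have UN: "(\<Union>I\<in>D1. S I) = D2"
      using sub by (fastforce simp: S_def)
    have "S I \<inter> S J = {}" if "I \<in> D1" "J \<in> D1" "I \<noteq> J" for I J
      using disj1[OF that] packingD(2)[OF D2] by (fastforce simp: S_def disjnt_iff)
    then have S_sum: "incr h D2 = (\<Sum>I\<in>D1. incr h (S I))" for h
      unfolding incr_def UN[symmetric] using fin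
      by (intro sum.UNION_disjoint) (auto simp: S_def)
    have "G I \<inter> G J = {}" if "I \<in> D1" "J \<in> D1" "I \<noteq> J" for I J
      using disj1[OF that] G(2)[OF that(1)] G(2)[OF that(2)] by (fastforce simp: disjnt_iff)
    then have "incr h (\<Union>I\<in>D1. G I) = (\<Sum>I\<in>D1. incr h (G I))" for h
      unfolding incr_def using fin G(1) by (intro sum.UNION_disjoint) auto
    also have "\<dots> h = (\<Sum>I\<in>D1. h (snd I) - h (fst I)) - incr h D2" for h
      unfolding S_sum by (simp add: G(4) sum_subtractf)
    also have "\<dots> h = incr h D1 - incr h D2" for h
      by (simp add: incr_def case_prod_unfold)
    finally have G_sum: "incr h (\<Union>I\<in>D1. G I) = incr h D1 - incr h D2" for h .
    have "(\<Sum>(u, v)\<in>(\<Union>I\<in>D1. G I). \<bar>f v - f u\<bar>) < \<eta>"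
    proof (rule ac)
      show "finite (\<Union>I\<in>D1. G I)" using fin G(1) by blast
      show "\<forall>(u, v)\<in>(\<Union>I\<in>D1. G I). a \<le> u \<and> u \<le> v \<and> v \<le> b"
      proof clarify
        fix x y u v assume "(x, y) \<in> D1" "(u, v) \<in> G (x, y)"
        then show "a \<le> u \<and> u \<le> v \<and> v \<le> b"
          using G(2)[of "(x, y)" u v] packingD(2)[OF D1, of x y] by auto
      qed
      show "disjoint_family_on (\<lambda>(u, v). {u<..<v}) (\<Union>I\<in>D1. G I)"
        unfolding disjoint_family_on_def
      proof (intro ballI impI, rule ccontr)
        fix p q assume "p \<in> (\<Union>I\<in>D1. G I)" "q \<in> (\<Union>I\<in>D1. G I)" and "p \<noteq> q"
          and ne: "(case p of (x, y) \<Rightarrow> {x<..<y}) \<inter> (case q of (x, y) \<Rightarrow> {x<..<y}) \<noteq> {}"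
        then obtain I J x y x' y' where *: "I \<in> D1" "(x, y) \<in> G I" "J \<in> D1" "(x', y') \<in> G J"
          and pq: "p = (x, y)" "q = (x', y')" "(x, y) \<noteq> (x', y')"
          by (cases p; cases q) blast
        then have "{x<..<y} \<inter> {x'<..<y'} \<noteq> {}" using ne by simp
        then obtain w where w: "x < w" "w < y" "x' < w" "w < y'"
          using greaterThanLessThan_iff by blast
        have "w \<in> {fst I..snd I}" "w \<in> {fst J..snd J}" using * G(2) w by fastforce+
        then have "I = J" using disj1[OF *(1,3)] by (meson disjnt_iff)
        then have "{x<..<y} \<inter> {x'<..<y'} = {}"
          using G(3)[of I] * pq unfolding disjoint_family_on_def by fastforce
        then show False using w by auto
      qed
      show "(\<Sum>(u, v)\<in>(\<Union>I\<in>D1. G I). v - u) < \<delta>"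
        using G_sum[of id] less by (simp add: incr_def)
    qed
    moreover have "\<bar>incr f (\<Union>I\<in>D1. G I)\<bar> \<le> (\<Sum>(u, v)\<in>(\<Union>I\<in>D1. G I). \<bar>f v - f u\<bar>)"
      unfolding incr_def case_prod_unfold by (rule sum_abs)
    ultimately show ?thesis using G_sum[of f] by simp
  qed
  then show ?thesis using that \<delta> by blast
qed


text \<open>Vitali's theorem gives a countable disjoint subfamily that covers \<open>E\<close> up to
  a null set. Passing to open intervals loses only countably many endpoints, and continuity of the
  measure from below cuts the family down to a finite one at the price of
  \<open>\<epsilon>\<close>.\<close>

lemma vitali_packing:
  assumes E: "E \<in> sets lebesgue" "E \<subseteq> {a..b}"
    and K: "\<And>x d. x \<in> E \<Longrightarrow> 0 < d \<Longrightarrow> \<exists>u v. (u, v) \<in> K \<and> u \<le> x \<and> x \<le> v \<and> v - u < d"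
    and K_sub: "\<And>u v. (u, v) \<in> K \<Longrightarrow> a \<le> u \<and> u < v \<and> v \<le> b"
    and "\<epsilon> > 0"
  obtains D where "D \<subseteq> K" "packing a b D"
    "measure lebesgue E - \<epsilon> < measure lebesgue (E \<inter> (\<Union>(u, v)\<in>D. {u<..<v}))"
proof -
  let ?c = "\<lambda>I :: real \<times> real. (fst I + snd I) / 2"
  let ?r = "\<lambda>I :: real \<times> real. (snd I - fst I) / 2"
  have cb: "cball (?c I) (?r I) = {fst I..snd I}" for I
    by (simp add: cball_eq_atLeastAtMost field_simps)
  obtain C where C: "countable C" "C \<subseteq> K"
     "pairwise (\<lambda>i j. disjnt (cball (?c i) (?r i)) (cball (?c j) (?r j))) C"
     "negligible (E - (\<Union>i \<in> C. cball (?c i) (?r i)))"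
  proof (rule Vitali_covering_theorem_cballs[of K ?r E ?c])
    show "0 < ?r I" if "I \<in> K" for I using K_sub[of "fst I" "snd I"] that by simp
    show "\<exists>I. I \<in> K \<and> x \<in> cball (?c I) (?r I) \<and> ?r I < d" if x: "x \<in> E" "0 < d" for x d
    proof -
      obtain u v where "(u, v) \<in> K" "u \<le> x" "x \<le> v" "v - u < d" using K[OF x] by blast
      then show ?thesis unfolding cb by (intro exI[of _ "(u, v)"]) auto
    qed
  qed blast
  define U where "U D = (\<Union>(u, v)\<in>D. {u<..<v})" for D :: "(real \<times> real) set"
  have pack: "packing a b D" if "finite D" "D \<subseteq> C" for D
    using that C(2,3) K_sub unfolding packing_def cb by (auto intro: pairwise_subset)
  have Uo: "open (U D)" for D unfolding U_def by (auto intro!: open_UN)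
  have EU: "E \<inter> U D \<in> lmeasurable" for D
    by (rule bounded_set_imp_lmeasurable)
      (use E Uo in \<open>auto intro!: bounded_subset[OF bounded_closed_interval[of a b]] sets.Int\<close>)
  have "E - U C \<subseteq> (E - (\<Union>i \<in> C. cball (?c i) (?r i))) \<union> (fst ` C \<union> snd ` C)"
    unfolding cb U_def by (force simp: less_le)
  moreover have "negligible (fst ` C \<union> snd ` C)"
    using C(1) by (simp add: countable_imp_null_set_lborel negligible_iff_null_sets null_sets_completionI)
  ultimately have "negligible (E - U C)"
    using C(4) by (meson negligible_Un negligible_subset)
  moreover have "E = (E \<inter> U C) \<union> (E - U C)" by blast
  ultimately have mE: "measure lebesgue E = measure lebesgue (E \<inter> U C)"
    by (metis EU measure_negligible_symdiff measurable_Un_null_set  negligible_iff_null_sets measure_Un_null_set fmeasurableD)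
  show ?thesis
  proof (cases "C = {}")
    case True
    then have "measure lebesgue E = 0" using mE by (simp add: U_def)
    then show ?thesis using that[of "{}"] \<open>\<epsilon> > 0\<close> by (simp add: packing_def)
  next
    case False
    \<comment> \<open>Finite initial segments of an enumeration of \<open>C\<close>; such an
      enumeration exists only for nonempty \<open>C\<close>, hence the case split.\<close>
    define D where "D n = from_nat_into C ` {..n}" for n :: nat
    have DC: "D n \<subseteq> C" for n
      unfolding D_def using from_nat_into[OF False] by blast
    have "(\<Union>n. D n) = C"
      
    proof
      show "C \<subseteq> (\<Union>n. D n)"
      proof
        fix I assume "I \<in> C"
        then obtain n where "from_nat_into C n = I" using from_nat_into_surj[OF C(1)] by blast
        then show "I \<in> (\<Union>n. D n)" unfolding D_def by blast
      qed
    qed (use DC in blast)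
    then have UU: "(\<Union>n. E \<inter> U (D n)) = E \<inter> U C" unfolding U_def by blast
    have "incseq (\<lambda>n. E \<inter> U (D n))"
      unfolding incseq_def U_def D_def by fastforce
    then have "(\<lambda>n. measure lebesgue (E \<inter> U (D n))) \<longlonglongrightarrow> measure lebesgue (\<Union>n. E \<inter> U (D n))"
      using EU fmeasurableD2[OF EU[of C]] by (intro Lim_measure_incseq) (auto simp del: UN_simps simp: UU)
    then have "eventually (\<lambda>n. measure lebesgue E - \<epsilon> < measure lebesgue (E \<inter> U (D n))) sequentially"
      unfolding UU mE by (rule order_tendstoD) (use \<open>\<epsilon> > 0\<close> in simp)
    then obtain n where "measure lebesgue E - \<epsilon> < measure lebesgue (E \<inter> U (D n))"
      using eventually_happens'[OF sequentially_bot] by blast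
    then show ?thesis
      using that[of "D n"] DC[of n] C(2) pack[OF _ DC, of n] unfolding U_def by (simp add: D_def)
  qed
qed

section \<open>Almost everywhere differentiability of absolutely continuous functions\<close>

lemma measure_packing:
  assumes "packing a b D"
  shows "measure lebesgue (\<Union>(u, v)\<in>D. {u<..<v}) = incr id D"
    and "(\<Union>(u, v)\<in>D. {u<..<v}) \<in> lmeasurable"
proof -
  have "measure lebesgue (\<Union>I\<in>D. {fst I<..<snd I}) = (\<Sum>I\<in>D. measure lebesgue {fst I<..<snd I})"
  proof (rule measure_UNION')
    show "finite D" using assms by (rule packingD)
    show "pairwise (\<lambda>I J. disjnt {fst I<..<snd I} {fst J<..<snd J}) D"
    proof (rule pairwise_mono)
      show "pairwise (\<lambda>I J. disjnt {fst I..snd I} {fst J..snd J}) D"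
        using assms by (simp add: packing_def)
      show "disjnt {fst I<..<snd I} {fst J<..<snd J}" if "disjnt {fst I..snd I} {fst J..snd J}"
        for I J :: "real \<times> real"
        using that by (rule disjnt_subset1[OF disjnt_subset2]) auto
    qed simp
  qed simp
  also have "\<dots> = (\<Sum>I\<in>D. snd I - fst I)"
    using assms by (intro sum.cong) (auto simp: packing_def)
  finally show "measure lebesgue (\<Union>(u, v)\<in>D. {u<..<v}) = incr id D"
    by (simp add: incr_def case_prod_unfold)
  show "(\<Union>(u, v)\<in>D. {u<..<v}) \<in> lmeasurable"
    using packingD(1)[OF assms] by (intro fmeasurable.finite_UN) auto
qed

section \<open>Straddling difference quotients and Lebesgue's differentiation theorem\<close>

definition steep :: "(real \<Rightarrow> real) \<Rightarrow> real \<Rightarrow> real \<Rightarrow> real \<Rightarrow> real set" where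
  "steep f a b q = {x. \<forall>d>0. \<exists>u v. a \<le> u \<and> u < x \<and> x < v \<and> v \<le> b \<and> v - u < d \<and>
                       q * (v - u) < f v - f u}"

lemma steepD:
  assumes "x \<in> steep f a b q" "0 < d"
  obtains u v where "a \<le> u" "u < x" "x < v" "v \<le> b" "v - u < d" "q * (v - u) < f v - f u"
  using assms unfolding steep_def by blast

lemma steep_subset: "steep f a b q \<subseteq> {a..b}"
proof
  fix x assume "x \<in> steep f a b q"
  then show "x \<in> {a..b}" by (rule steepD[where d=1]) auto
qed

lemma steep_mono: "x \<in> steep f a b q \<Longrightarrow> p \<le> q \<Longrightarrow> x \<in> steep f a b p"
  unfolding steep_def by (smt (verit, best) mem_Collect_eq mult_right_mono)

text \<open>A witness (u, v) for one point serves every point strictly between \<open>u\<close> and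
  \<open>v\<close>. So the set is a countable intersection of open sets, whatever \<open>f\<close>
  is.\<close>

lemma sets_steep [measurable]: "steep f a b q \<in> sets lebesgue"
proof -
  define A where "A n = {(u, v). a \<le> u \<and> v \<le> b \<and> v - u < 1 / Suc n \<and> q * (v - u) < f v - f u}" for n :: nat
  have "steep f a b q = (\<Inter>n. \<Union>(u, v)\<in>A n. {u<..<v})"
  proof (intro equalityI subsetI)
    fix x assume x: "x \<in> steep f a b q"
    show "x \<in> (\<Inter>n. \<Union>(u, v)\<in>A n. {u<..<v})"
    proof
      fix n :: nat
      have "0 < 1 / real (Suc n)" by simp
      then obtain u v where "a \<le> u" "u < x" "x < v" "v \<le> b" "v - u < 1 / real (Suc n)"
        "q * (v - u) < f v - f u" using steepD[OF x] by metis
      then show "x \<in> (\<Union>(u, v)\<in>A n. {u<..<v})" unfolding A_def by auto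
    qed
  next
    fix x assume x: "x \<in> (\<Inter>n. \<Union>(u, v)\<in>A n. {u<..<v})"
    show "x \<in> steep f a b q"
      unfolding steep_def
    proof (intro CollectI allI impI)
      fix d :: real assume "d > 0"
      then obtain n where n: "inverse (real (Suc n)) < d" using reals_Archimedean by blast
      have "x \<in> (\<Union>(u, v)\<in>A n. {u<..<v})" using x by blast
      then obtain u v where "(u, v) \<in> A n" "u < x" "x < v" by auto
      then show "\<exists>u v. a \<le> u \<and> u < x \<and> x < v \<and> v \<le> b \<and> v - u < d \<and> q * (v - u) < f v - f u"
        using n unfolding A_def by (intro exI[of _ u] exI[of _ v]) (auto simp: inverse_eq_divide)
    qed
  qed
  moreover have "open (\<Union>(u, v)\<in>A n. {u<..<v})" for n by (auto intro!: open_UN)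
  ultimately show ?thesis
    by (auto intro!: sets.countable_INT'' simp del: INT_simps)
qed

lemma steep_lmeasurable: "steep f a b q \<in> lmeasurable"
  using bounded_subset[OF bounded_closed_interval steep_subset] by (rule bounded_set_imp_lmeasurable) (rule sets_steep)

text \<open>Steepness of \<open>- f\<close> above \<open>- p\<close> says that \<open>f\<close> has
  straddling quotients below \<open>p\<close>, so one notion serves both directions. The signs of
  \<open>p\<close> and \<open>q\<close> are arbitrary, which is why \<open>\<bar>p\<bar>\<close>
  enters the constants.\<close>

lemma negligible_steep_both:
  assumes ac: "abs_continuous_on a b f" and "p < q"
  shows "negligible (steep f a b q \<inter> steep (\<lambda>x. - f x) a b (- p))"
proof (rule ccontr)
  define E where "E = steep f a b q \<inter> steep (\<lambda>x. - f x) a b (- p)"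
  define m where "m = measure lebesgue E"
  assume "\<not> negligible (steep f a b q \<inter> steep (\<lambda>x. - f x) a b (- p))"
  have E: "E \<in> lmeasurable" "E \<subseteq> {a..b}"
    using steep_lmeasurable steep_subset[of f a b q] unfolding E_def by (auto intro: fmeasurable.Int)
  have "m > 0"
    using \<open>\<not> negligible _\<close> negligible_iff_measure0[OF E(1)] unfolding m_def E_def by (simp add: zero_less_measure_iff)
  \<comment> \<open>The final estimate is (q - p) m < \<eta> + \<epsilon> M with \<epsilon> M \<le>
    \<eta>; its right side is at most half of the left side.\<close>
  define \<eta> where "\<eta> = (q - p) * m / 4"
  have "\<eta> > 0" using \<open>m > 0\<close> \<open>p < q\<close> by (simp add: \<eta>_def)
  then obtain \<delta> where "\<delta> > 0" and \<delta>: "\<And>D1 D2. packing a b D1 \<Longrightarrow> packing a b D2 \<Longrightarrow>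
       (\<And>x y. (x, y) \<in> D2 \<Longrightarrow> \<exists>(u, v)\<in>D1. u \<le> x \<and> y \<le> v) \<Longrightarrow>
       incr id D1 - incr id D2 < \<delta> \<Longrightarrow> \<bar>incr f D1 - incr f D2\<bar> < \<eta>"
    using abs_continuous_on_packing[OF ac] by blast
  \<comment> \<open>The lengths will satisfy m - 2\<epsilon> < |D2| \<le> |D1| < m + \<epsilon>.
    Replacing |D2| by m costs 2\<epsilon>(q - p), and the difference of the two lengths, at most
    3\<epsilon>, costs 3\<epsilon>|p|.\<close>
  define M where "M = 2 * (q - p) + 3 * \<bar>p\<bar>"
  have "M > 0" using \<open>p < q\<close> by (simp add: M_def)
  define \<epsilon> where "\<epsilon> = min (\<delta> / 4) (\<eta> / M)"
  have \<epsilon>: "\<epsilon> > 0" "3 * \<epsilon> < \<delta>" "\<epsilon> * M \<le> \<eta>"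
  proof -
    show "\<epsilon> > 0" using \<open>\<delta> > 0\<close> \<open>\<eta> > 0\<close> \<open>M > 0\<close> by (simp add: \<epsilon>_def)
    show "3 * \<epsilon> < \<delta>" using \<open>\<delta> > 0\<close> by (simp add: \<epsilon>_def min_def)
    have "\<epsilon> \<le> \<eta> / M" by (simp add: \<epsilon>_def)
    then show "\<epsilon> * M \<le> \<eta>" using \<open>M > 0\<close> by (simp add: pos_le_divide_eq)
  qed
  \<comment> \<open>The covering theorem bounds the length of a packing only from below. Keeping the
    intervals of \<open>D1\<close> inside an open set barely larger than \<open>E\<close> bounds
    their length from above.\<close>
  obtain T where T: "open T" "E \<subseteq> T" "T \<in> lmeasurable" "measure lebesgue T < m + \<epsilon>"
  proof -
    obtain T where T: "open T" "E \<subseteq> T" "T - E \<in> lmeasurable" "emeasure lebesgue (T - E) < ennreal \<epsilon>"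
      using sets_lebesgue_outer_open[OF fmeasurableD[OF E(1)] \<epsilon>(1)] by blast
    have "T = E \<union> (T - E)" using T(2) by blast
    then have "T \<in> lmeasurable" "measure lebesgue T \<le> m + measure lebesgue (T - E)"
      using E(1) T(3) unfolding m_def by (metis fmeasurable.Un, metis measure_Un_le fmeasurableD)
    moreover have "measure lebesgue (T - E) < \<epsilon>"
      using T(3,4) \<epsilon>(1) by (simp add: emeasure_eq_measure2 ennreal_less_iff)
    ultimately show ?thesis using that T(1,2) by force
  qed
  define K1 where "K1 = {(u, v). a \<le> u \<and> u < v \<and> v \<le> b \<and> {u..v} \<subseteq> T \<and> f v - f u < p * (v - u)}"
  obtain D1 where D1: "D1 \<subseteq> K1" "packing a b D1"
    "m - \<epsilon> < measure lebesgue (E \<inter> (\<Union>(u, v)\<in>D1. {u<..<v}))"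
  proof (rule vitali_packing[of E a b K1 \<epsilon>])
    fix x d :: real assume x: "x \<in> E" and "0 < d"
    obtain r where r: "r > 0" "ball x r \<subseteq> T" using T x openE by blast
    obtain u v where *: "a \<le> u" "u < x" "x < v" "v \<le> b" "v - u < min d r" "(- p) * (v - u) < - f v - - f u"
      using x r(1) \<open>0 < d\<close> steepD[of x "\<lambda>x. - f x" a b "- p" "min d r"] unfolding E_def by auto
    have "{u..v} \<subseteq> ball x r" using * by (auto simp: dist_real_def)
    then show "\<exists>u v. (u, v) \<in> K1 \<and> u \<le> x \<and> x \<le> v \<and> v - u < d"
      using * r(2) unfolding K1_def by (intro exI[of _ u] exI[of _ v]) auto
  qed (use E \<epsilon> in \<open>auto simp: K1_def m_def\<close>)
  define U where "U = (\<Union>(u, v)\<in>D1. {u<..<v})"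
  define K2 where "K2 = {(u, v). u < v \<and> (\<exists>(u', v')\<in>D1. u' \<le> u \<and> v \<le> v') \<and> q * (v - u) < f v - f u}"
  have U: "open U" "U \<subseteq> T"
  proof -
    show "open U" unfolding U_def by (auto intro!: open_UN)
    show "U \<subseteq> T"
    proof
      fix x assume "x \<in> U"
      then obtain u v where "(u, v) \<in> D1" "u < x" "x < v" unfolding U_def by auto
      then have "{u..v} \<subseteq> T" "x \<in> {u..v}" using D1(1) unfolding K1_def by auto
      then show "x \<in> T" by blast
    qed
  qed
  \<comment> \<open>The set to be covered is \<open>E \<inter> U\<close>, because a point interior
    to an interval of \<open>D1\<close> has all its short straddling intervals inside that interval.
    So the steep packing refines \<open>D1\<close>.\<close>
  obtain D2 where D2: "D2 \<subseteq> K2" "packing a b D2"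
    "measure lebesgue (E \<inter> U) - \<epsilon> < measure lebesgue (E \<inter> U \<inter> (\<Union>(u, v)\<in>D2. {u<..<v}))"
  proof (rule vitali_packing[of "E \<inter> U" a b K2 \<epsilon>])
    show "E \<inter> U \<in> sets lebesgue" using E(1) U(1) by (auto intro: fmeasurableD)
    show "a \<le> u \<and> u < v \<and> v \<le> b" if "(u, v) \<in> K2" for u v
      using that packingD(2)[OF D1(2)] unfolding K2_def by fastforce
    fix x d :: real assume x: "x \<in> E \<inter> U" and "0 < d"
    then obtain u' v' where uv': "(u', v') \<in> D1" "u' < x" "x < v'" unfolding U_def by auto
    define r where "r = Min {d, x - u', v' - x}"
    have r: "r > 0" "r \<le> d" "r \<le> x - u'" "r \<le> v' - x" using uv' \<open>0 < d\<close> by (auto simp: r_def)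
    obtain u v where *: "a \<le> u" "u < x" "x < v" "v \<le> b" "v - u < r" "q * (v - u) < f v - f u"
      using x r(1) steepD[of x f a b q r] unfolding E_def by auto
    then show "\<exists>u v. (u, v) \<in> K2 \<and> u \<le> x \<and> x \<le> v \<and> v - u < d"
      using r uv'(1) unfolding K2_def by (intro exI[of _ u] exI[of _ v]) (auto intro!: bexI[of _ "(u', v')"])
  qed (use E \<epsilon> in auto)
  define V where "V = (\<Union>(u, v)\<in>D2. {u<..<v})"
  have "V \<subseteq> U"
  proof
    fix x assume "x \<in> V"
    then obtain u v where uv: "(u, v) \<in> D2" "u < x" "x < v" unfolding V_def by auto
    then obtain u' v' where "(u', v') \<in> D1" "u' \<le> u" "v \<le> v'" using D2(1) unfolding K2_def by auto
    then have "(u', v') \<in> D1" "x \<in> {u'<..<v'}" using uv by auto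
    then show "x \<in> U" unfolding U_def by blast
  qed
  have mUV: "measure lebesgue U = incr id D1" "measure lebesgue V = incr id D2" "U \<in> lmeasurable" "V \<in> lmeasurable"
    unfolding U_def V_def using measure_packing D1(2) D2(2) by auto
  have "incr id D1 < m + \<epsilon>"
    using measure_mono_fmeasurable[OF U(2) _ T(3)] mUV T(4) by (simp add: fmeasurableD)
  moreover have "incr id D2 \<le> incr id D1"
    using measure_mono_fmeasurable[OF \<open>V \<subseteq> U\<close> fmeasurableD[OF mUV(4)] mUV(3)] mUV(1,2) by simp
  moreover have "measure lebesgue (E \<inter> U \<inter> V) \<le> measure lebesgue V"
    using E(1) mUV by (intro measure_mono_fmeasurable) (auto intro: fmeasurableD)
  then have "m - 2 * \<epsilon> < incr id D2"
    using D1(3) D2(3) mUV unfolding U_def[symmetric] V_def[symmetric] by linarith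
  ultimately have s: "m - 2 * \<epsilon> < incr id D2" "0 \<le> incr id D1 - incr id D2" "incr id D1 - incr id D2 \<le> 3 * \<epsilon>"
    by linarith+
  have "\<exists>(u, v)\<in>D1. u \<le> x \<and> y \<le> v" if "(x, y) \<in> D2" for x y
    using D2(1) that unfolding K2_def by auto
  then have "\<bar>incr f D1 - incr f D2\<bar> < \<eta>"
    using \<delta>[OF D1(2) D2(2)] s(3) \<epsilon>(2) by fastforce
  moreover have "incr f D1 \<le> p * incr id D1"
    unfolding incr_def sum_distrib_left using D1(1) by (intro sum_mono) (auto simp: K1_def)
  moreover have "q * incr id D2 \<le> incr f D2"
    unfolding incr_def sum_distrib_left using D2(1) by (intro sum_mono) (auto simp: K2_def)
  ultimately have "q * incr id D2 - p * incr id D1 < \<eta>" by linarith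
  then have "(q - p) * incr id D2 - p * (incr id D1 - incr id D2) < \<eta>"
    by (simp add: algebra_simps)
  moreover have "(q - p) * (m - 2 * \<epsilon>) \<le> (q - p) * incr id D2"
    using s(1) \<open>p < q\<close> by (intro mult_left_mono) auto
  moreover have "p * (incr id D1 - incr id D2) \<le> \<bar>p\<bar> * (3 * \<epsilon>)"
    using s by (intro mult_mono) auto
  ultimately have "(q - p) * m < \<eta> + \<epsilon> * M"
    unfolding M_def by (simp add: algebra_simps)
  then show False using \<epsilon>(3) \<open>\<eta> > 0\<close> unfolding \<eta>_def by linarith
qed

text \<open>Increments over a packing of length below \<open>\<delta>\<close> stay below 1, whereas
  slopes above \<open>n\<close> over a packing of length more than m/2 give more than n m / 2, which
  exceeds 1 for large \<open>n\<close>.\<close>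

lemma negligible_steep_infinite:
  assumes ac: "abs_continuous_on a b f"
  shows "negligible (\<Inter>n. steep f a b (real n))"
proof -
  obtain \<delta> where "\<delta> > 0" and \<delta>: "\<And>D1 D2. packing a b D1 \<Longrightarrow> packing a b D2 \<Longrightarrow>
       (\<And>x y. (x, y) \<in> D2 \<Longrightarrow> \<exists>(u, v)\<in>D1. u \<le> x \<and> y \<le> v) \<Longrightarrow>
       incr id D1 - incr id D2 < \<delta> \<Longrightarrow> \<bar>incr f D1 - incr f D2\<bar> < 1"
    using abs_continuous_on_packing[OF ac, of 1] by auto
  \<comment> \<open>Comparison with the empty packing.\<close>
  have short: "incr f D < 1" if "packing a b D" "incr id D < \<delta>" for D
    using \<delta>[OF that(1), of "{}"] that(2) by (auto simp: packing_def incr_def)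
  define E where "E = (\<Inter>n. steep f a b (real n))"
  have E_sub: "E \<subseteq> {a..b}"
    unfolding E_def using INT_lower[OF UNIV_I] steep_subset by (rule order_trans)
  \<comment> \<open>A window of width 2\<delta>/3 keeps every packing inside it shorter than
    \<open>\<delta>\<close>. Negligibility is a local property, so windows suffice.\<close>
  have "negligible (E \<inter> {x - \<delta>/3<..<x + \<delta>/3})" for x
  proof (rule ccontr)
    define F where "F = E \<inter> {x - \<delta>/3<..<x + \<delta>/3}"
    assume "\<not> negligible (E \<inter> {x - \<delta>/3<..<x + \<delta>/3})"
    moreover have F: "F \<in> lmeasurable" "F \<subseteq> {a..b}"
      using E_sub unfolding F_def E_def
      by (auto intro!: bounded_set_imp_lmeasurable sets.Int bounded_subset[OF bounded_closed_interval[of "x - \<delta>/3" "x + \<delta>/3"]])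
    define m where "m = measure lebesgue F"
    ultimately have "m > 0"
      using negligible_iff_measure0[OF F(1)] unfolding m_def F_def by (simp add: zero_less_measure_iff)
    obtain n where n: "2 / m < real n" using reals_Archimedean2 by blast
    define K where "K = {(u, v). a \<le> u \<and> u < v \<and> v \<le> b \<and> x - \<delta>/3 < u \<and> v < x + \<delta>/3 \<and> real n * (v - u) < f v - f u}"
    obtain D where D: "D \<subseteq> K" "packing a b D"
      "m - m / 2 < measure lebesgue (F \<inter> (\<Union>(u, v)\<in>D. {u<..<v}))"
    proof (rule vitali_packing[of F a b K "m/2"])
      fix w d :: real assume w: "w \<in> F" and "0 < d"
      define r where "r = Min {d, w - (x - \<delta>/3), x + \<delta>/3 - w}"
      have r: "r > 0" "r \<le> d" "r \<le> w - (x - \<delta>/3)" "r \<le> x + \<delta>/3 - w"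
        using w \<open>0 < d\<close> by (auto simp: r_def F_def)
      obtain u v where *: "a \<le> u" "u < w" "w < v" "v \<le> b" "v - u < r" "real n * (v - u) < f v - f u"
        using w r(1) steepD[of w f a b "real n" r] unfolding F_def E_def by auto
      then show "\<exists>u v. (u, v) \<in> K \<and> u \<le> w \<and> w \<le> v \<and> v - u < d"
        using r unfolding K_def by (intro exI[of _ u] exI[of _ v]) auto
    qed (use F \<open>m > 0\<close> in \<open>auto simp: K_def m_def\<close>)
    have mD: "measure lebesgue (\<Union>(u, v)\<in>D. {u<..<v}) = incr id D" "(\<Union>(u, v)\<in>D. {u<..<v}) \<in> lmeasurable"
      using measure_packing D(2) by auto
    have "(\<Union>(u, v)\<in>D. {u<..<v}) \<subseteq> {x - \<delta>/3..x + \<delta>/3}"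
      using D(1) unfolding K_def by force
    then have "incr id D \<le> measure lebesgue {x - \<delta>/3..x + \<delta>/3}"
      using mD by (metis measure_mono_fmeasurable fmeasurableD lmeasurable_interval(1) cbox_interval)
    then have "incr f D < 1"
      using \<open>\<delta> > 0\<close> short[OF D(2)] by simp
    moreover have "real n * incr id D \<le> incr f D"
      unfolding incr_def sum_distrib_left using D(1) by (intro sum_mono) (auto simp: K_def)
    moreover have "measure lebesgue (F \<inter> (\<Union>(u, v)\<in>D. {u<..<v})) \<le> incr id D"
      unfolding mD(1)[symmetric] using F(1) mD(2) by (intro measure_mono_fmeasurable) (auto intro: fmeasurableD)
    then have "real n * (m / 2) \<le> real n * incr id D"
      using D(3) by (intro mult_left_mono) auto
    moreover have "1 < real n * (m / 2)" using n \<open>m > 0\<close> by (simp add: field_simps)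
    ultimately show False by linarith
  qed
  moreover have "openin (top_of_set E) (E \<inter> {x - \<delta>/3<..<x + \<delta>/3})" for x
    by (intro openin_open_Int) simp
  ultimately have "\<forall>x\<in>E. \<exists>U. openin (top_of_set E) U \<and> x \<in> U \<and> negligible U"
    using \<open>\<delta> > 0\<close> by (intro ballI, rule_tac x="E \<inter> {x - \<delta>/3<..<x + \<delta>/3}" in exI) auto
  then show ?thesis
    unfolding E_def by (rule iffD2[OF locally_negligible_alt])
qed

lemma abs_continuous_on_continuous_on:
  assumes "abs_continuous_on a b f"
  shows "continuous_on {a..b} f"
  unfolding continuous_on_iff
proof (intro ballI allI impI)
  fix x e :: real assume x: "x \<in> {a..b}" and "e > 0"
  then obtain d where "d > 0" and d: "\<And>I. finite I \<Longrightarrow> (\<forall>(u, v)\<in>I. a \<le> u \<and> u \<le> v \<and> v \<le> b) \<Longrightarrow>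
        disjoint_family_on (\<lambda>(u, v). {u<..<v}) I \<Longrightarrow>
        (\<Sum>(u, v)\<in>I. v - u) < d \<Longrightarrow> (\<Sum>(u, v)\<in>I. \<bar>f v - f u\<bar>) < e"
    using assms[unfolded abs_continuous_on_def, rule_format, OF \<open>e > 0\<close>] by blast
  have "dist (f y) (f x) < e" if "y \<in> {a..b}" "dist y x < d" for y
    using d[of "{(x, y)}"] d[of "{(y, x)}"] that x
    by (cases "x \<le> y") (auto simp: disjoint_family_on_def dist_real_def abs_minus_commute)
  then show "\<exists>d>0. \<forall>y\<in>{a..b}. dist y x < d \<longrightarrow> dist (f y) (f x) < e"
    using \<open>d > 0\<close> by blast
qed

text \<open>One endpoint of the straddling interval is sent to \<open>x\<close>. Continuity of
  \<open>f\<close> at \<open>x\<close> preserves the estimate in the limit, with the same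
  \<epsilon>, and yields the difference quotient based at \<open>x\<close> on either side.\<close>

lemma straddle_imp_has_derivative:
  assumes x: "a < x" "x < b" and cont: "isCont f x"
    and str: "\<And>\<epsilon>. \<epsilon> > 0 \<Longrightarrow> \<exists>d>0. \<forall>u v. a \<le> u \<and> u < x \<and> x < v \<and> v \<le> b \<and> v - u < d \<longrightarrow>
                 \<bar>f v - f u - D * (v - u)\<bar> \<le> \<epsilon> * (v - u)"
  shows "(f has_real_derivative D) (at x)"
  unfolding has_field_derivative_def has_derivative_at_alt
proof (intro conjI allI impI)
  show "bounded_linear ((*) D)" by (rule bounded_linear_mult_right)
  fix e :: real assume "e > 0"
  then obtain d where "d > 0" and d: "\<And>u v. a \<le> u \<Longrightarrow> u < x \<Longrightarrow> x < v \<Longrightarrow> v \<le> b \<Longrightarrow> v - u < d \<Longrightarrow>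
      \<bar>f v - f u - D * (v - u)\<bar> \<le> e * (v - u)" using str by blast
  define d' where "d' = Min {d, x - a, b - x}"
  have d': "d' > 0" "d' \<le> d" "d' \<le> x - a" "d' \<le> b - x" using \<open>d > 0\<close> x by (auto simp: d'_def)
  have fx: "(f \<longlongrightarrow> f x) (at_left x)" "(f \<longlongrightarrow> f x) (at_right x)"
    using cont by (auto simp: isCont_def filterlim_at_split)
  have "\<bar>f y - f x - D * (y - x)\<bar> \<le> e * \<bar>y - x\<bar>" if y: "\<bar>y - x\<bar> < d'" for y
  proof (cases y x rule: linorder_cases)
    case less
    have ev: "\<forall>\<^sub>F v in at_right x. \<bar>f v - f y - D * (v - y)\<bar> \<le> e * (v - y)"
    proof (rule eventually_mono[OF eventually_at_right_real])
      show "x < y + d'" using y by linarith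
      show "\<bar>f v - f y - D * (v - y)\<bar> \<le> e * (v - y)" if "v \<in> {x<..<y + d'}" for v
        using that less y d' by (intro d) auto
    qed
    have "\<bar>f x - f y - D * (x - y)\<bar> \<le> e * (x - y)"
      by (rule tendsto_le[OF _ _ _ ev]) (auto intro!: tendsto_intros fx)
    then show ?thesis using less by (simp add: abs_if algebra_simps split: if_splits)
  next
    case greater
    have ev: "\<forall>\<^sub>F u in at_left x. \<bar>f y - f u - D * (y - u)\<bar> \<le> e * (y - u)"
    proof (rule eventually_mono[OF eventually_at_left_real])
      show "y - d' < x" using y by linarith
      show "\<bar>f y - f u - D * (y - u)\<bar> \<le> e * (y - u)" if "u \<in> {y - d'<..<x}" for u
        using that greater y d' by (intro d) auto
    qed
    have "\<bar>f y - f x - D * (y - x)\<bar> \<le> e * (y - x)"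
      by (rule tendsto_le[OF _ _ _ ev]) (auto intro!: tendsto_intros fx)
    then show ?thesis using greater by simp
  qed simp
  then show "\<exists>d>0. \<forall>y. norm (y - x) < d \<longrightarrow> norm (f y - f x - D * (y - x)) \<le> e * norm (y - x)"
    using d'(1) by auto
qed

lemma not_steepE:
  assumes "x \<notin> steep f a b q"
  obtains d where "d > 0"
    "\<And>u v. a \<le> u \<Longrightarrow> u < x \<Longrightarrow> x < v \<Longrightarrow> v \<le> b \<Longrightarrow> v - u < d \<Longrightarrow> f v - f u \<le> q * (v - u)"
proof -
  obtain d where "d > 0" and d: "\<not> (\<exists>u v. a \<le> u \<and> u < x \<and> x < v \<and> v \<le> b \<and> v - u < d \<and> q * (v - u) < f v - f u)"
    using assms unfolding steep_def by blast
  have "f v - f u \<le> q * (v - u)" if "a \<le> u" "u < x" "x < v" "v \<le> b" "v - u < d" for u v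
    using d that not_less by blast
  then show thesis using that \<open>d > 0\<close> by blast
qed

text \<open>The derivative is the supremum \<open>D\<close> of the slopes \<open>q\<close> at which
  \<open>x\<close> is steep. Nothing above \<open>D\<close> is steep by definition; a quotient of
  \<open>f\<close> below \<open>D - \<epsilon>\<close> at all small scales would leave a gap between
  two rational slopes, which is excluded off \<open>N\<close>. The endpoints belong to
  \<open>N\<close> so that \<open>x\<close> can be straddled inside [a, b].\<close>

theorem abs_continuous_on_differentiable_AE:
  assumes ac: "abs_continuous_on a b f"
  obtains N where "negligible N" "\<And>x. x \<in> {a..b} - N \<Longrightarrow> f differentiable (at x)"
proof -
  let ?g = "\<lambda>x. - f x"
  have ac': "abs_continuous_on a b ?g"
    using ac unfolding abs_continuous_on_def by (simp add: abs_minus_commute)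
  define N where "N = (\<Inter>n. steep f a b (real n)) \<union> (\<Inter>n. steep ?g a b (real n)) \<union>
     (\<Union>(p, q)\<in>{(p, q)\<in>\<rat> \<times> \<rat>. p < q}. steep f a b q \<inter> steep ?g a b (- p)) \<union> {a, b}"
  have "countable {(p, q)\<in>\<rat> \<times> \<rat>. p < (q::real)}"
    by (rule countable_subset[of _ "\<rat> \<times> \<rat>"]) (auto intro: countable_rat)
  then have "negligible (\<Union>(p, q)\<in>{(p, q)\<in>\<rat> \<times> \<rat>. p < q}. steep f a b q \<inter> steep ?g a b (- p))"
    by (rule negligible_countable_Union[OF countable_image]) (auto intro: negligible_steep_both[OF ac])
  then have neg: "negligible N"
    unfolding N_def
    by (intro negligible_Un negligible_steep_infinite ac ac') auto
  have "f differentiable (at x)" if x: "x \<in> {a..b} - N" for x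
  proof -
    have ab: "a < x" "x < b" using x unfolding N_def by auto
    have "\<exists>n. x \<notin> steep f a b (real n)" "\<exists>n. x \<notin> steep ?g a b (real n)"
      using x unfolding N_def by blast+
    then obtain n n' where n: "x \<notin> steep f a b (real n)" "x \<notin> steep ?g a b (real n')" by blast
    \<comment> \<open>Two rationals between \<open>p\<close> and \<open>q\<close> reduce an
      arbitrary gap to one of the countably many null sets collected in \<open>N\<close>.\<close>
    have gap: False if p: "x \<in> steep ?g a b (- p)" and q: "x \<in> steep f a b q" and "p < q" for p q
    proof -
      obtain p' where p': "p' \<in> \<rat>" "p < p'" "p' < q" using Rats_dense_in_real[OF \<open>p < q\<close>] by blast
      obtain q' where q': "q' \<in> \<rat>" "p' < q'" "q' < q" using Rats_dense_in_real[OF p'(3)] by blast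
      have "x \<in> steep ?g a b (- p')" "x \<in> steep f a b q'"
        using steep_mono[OF p, of "- p'"] steep_mono[OF q, of q'] p' q' by auto
      then have "x \<in> N" unfolding N_def using p' q' by blast
      then show False using x by blast
    qed
    define S where "S = {q. x \<in> steep f a b q}"
    have bdd: "bdd_above S"
      unfolding S_def using n(1) steep_mono[of x f a b _ "real n"]
      by (intro bdd_aboveI[of _ "real n"]) (force simp: not_le[symmetric])
    \<comment> \<open>If \<open>S\<close> were empty, all short straddling quotients would be at
      most -n' - 1, while those of \<open>- f\<close> are at most n'. An interval symmetric about
      \<open>x\<close> contradicts this.\<close>
    have "S \<noteq> {}"
    proof
      assume "S = {}"
      then have "x \<notin> steep f a b (- real n' - 1)" unfolding S_def by blast
      then obtain d where "d > 0" and d: "\<And>u v. a \<le> u \<Longrightarrow> u < x \<Longrightarrow> x < v \<Longrightarrow> v \<le> b \<Longrightarrow> v - u < d \<Longrightarrow>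
          f v - f u \<le> (- real n' - 1) * (v - u)" by (rule not_steepE) (rule that)
      obtain d2 where "d2 > 0" and d2: "\<And>u v. a \<le> u \<Longrightarrow> u < x \<Longrightarrow> x < v \<Longrightarrow> v \<le> b \<Longrightarrow> v - u < d2 \<Longrightarrow>
          - f v - - f u \<le> real n' * (v - u)" using n(2) by (rule not_steepE) (rule that)
      define r where "r = Min {d, d2, x - a, b - x} / 3"
      have r: "r > 0" "2 * r < d" "2 * r < d2" "r < x - a" "r < b - x"
        using \<open>d > 0\<close> \<open>d2 > 0\<close> ab unfolding r_def by (auto simp: min_def)
      have "f (x + r) - f (x - r) \<le> (- real n' - 1) * (2 * r)"
        using d[of "x - r" "x + r"] r by simp
      moreover have "- f (x + r) - - f (x - r) \<le> real n' * (2 * r)"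
        using d2[of "x - r" "x + r"] r by simp
      ultimately show False using r(1) by (simp add: algebra_simps)
    qed
    define D where "D = Sup S"
    have "(f has_real_derivative D) (at x)"
    proof (rule straddle_imp_has_derivative[OF ab])
      show "isCont f x"
        using abs_continuous_on_continuous_on[OF ac] ab by (simp add: continuous_on_interior)
      fix \<epsilon> :: real assume "\<epsilon> > 0"
      have "x \<notin> steep f a b (D + \<epsilon>)"
        using cSup_upper[OF _ bdd, of "D + \<epsilon>"] \<open>\<epsilon> > 0\<close> unfolding D_def S_def by auto
      then obtain d where "d > 0" and d: "\<And>u v. a \<le> u \<Longrightarrow> u < x \<Longrightarrow> x < v \<Longrightarrow> v \<le> b \<Longrightarrow> v - u < d \<Longrightarrow>
          f v - f u \<le> (D + \<epsilon>) * (v - u)" by (rule not_steepE) (rule that)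
      obtain q where "q \<in> S" "D - \<epsilon> < q"
        using less_cSup_iff[OF \<open>S \<noteq> {}\<close> bdd, of "D - \<epsilon>"] \<open>\<epsilon> > 0\<close> unfolding D_def by auto
      then have "x \<notin> steep ?g a b (- (D - \<epsilon>))" using gap unfolding S_def by blast
      then obtain d2 where "d2 > 0" and d2: "\<And>u v. a \<le> u \<Longrightarrow> u < x \<Longrightarrow> x < v \<Longrightarrow> v \<le> b \<Longrightarrow> v - u < d2 \<Longrightarrow>
          - f v - - f u \<le> - (D - \<epsilon>) * (v - u)" by (rule not_steepE) (rule that)
      show "\<exists>d>0. \<forall>u v. a \<le> u \<and> u < x \<and> x < v \<and> v \<le> b \<and> v - u < d \<longrightarrow>
                 \<bar>f v - f u - D * (v - u)\<bar> \<le> \<epsilon> * (v - u)"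
      proof (intro exI[of _ "min d d2"] conjI allI impI)
        fix u v assume uv: "a \<le> u \<and> u < x \<and> x < v \<and> v \<le> b \<and> v - u < min d d2"
        then show "\<bar>f v - f u - D * (v - u)\<bar> \<le> \<epsilon> * (v - u)"
          using d[of u v] d2[of u v] by (auto simp: abs_le_iff algebra_simps)
      qed (use \<open>d > 0\<close> \<open>d2 > 0\<close> in simp)
    qed
    then show ?thesis by (auto simp: real_differentiable_def)
  qed
  then show ?thesis using that neg by blast
qed

section \<open>Caputo derivatives of ramps\<close>

definition ramp :: "real \<Rightarrow> real \<Rightarrow> real" where
  "ramp c x = max 0 (x - c)"

text \<open>For a \<le> c \<le> b this is the combined Caputo derivative of \<open>ramp c\<close> on
  [a, b]: each term integrates its kernel over the part of the range beyond \<open>c\<close>, where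
  the ramp has slope 1. The first term vanishes for x \<le> c; the second also sees the ramp from
  the left of \<open>c\<close>.\<close>

definition ramp_caputo :: "real \<Rightarrow> real \<Rightarrow> real \<Rightarrow> real \<Rightarrow> real \<Rightarrow> real \<Rightarrow> real" where
  "ramp_caputo b \<alpha> \<beta> \<gamma> c x =
     \<gamma> / Gamma (1 - \<alpha>) * (max 0 (x - c) powr (1 - \<alpha>) / (1 - \<alpha>)) -
     (1 - \<gamma>) / Gamma (1 - \<beta>) * (((b - x) powr (1 - \<beta>) - max 0 (c - x) powr (1 - \<beta>)) / (1 - \<beta>))"

section \<open>Adding a multiple of a ramp to an absolutely continuous function\<close>

lemma abs_continuous_on_add_Lipschitz:
  assumes ac: "abs_continuous_on a b f" and "K > 0" and lip: "\<And>u v. \<bar>g v - g u\<bar> \<le> K * \<bar>v - u\<bar>"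
  shows "abs_continuous_on a b (\<lambda>x. f x + g x)"
  unfolding abs_continuous_on_def
proof (intro allI impI)
  fix \<epsilon> :: real assume "\<epsilon> > 0"
  then have "\<epsilon> / 2 > 0" by simp
  then obtain d where "d > 0" and d: "\<And>I. finite I \<Longrightarrow> (\<forall>(u, v)\<in>I. a \<le> u \<and> u \<le> v \<and> v \<le> b) \<Longrightarrow>
        disjoint_family_on (\<lambda>(u, v). {u<..<v}) I \<Longrightarrow>
        (\<Sum>(u, v)\<in>I. v - u) < d \<Longrightarrow> (\<Sum>(u, v)\<in>I. \<bar>f v - f u\<bar>) < \<epsilon> / 2"
    using ac[unfolded abs_continuous_on_def, rule_format, of "\<epsilon> / 2"] by blast
  define \<delta> where "\<delta> = min d (\<epsilon> / (2 * K))"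
  have "\<delta> > 0" using \<open>d > 0\<close> \<open>\<epsilon> > 0\<close> \<open>K > 0\<close> by (simp add: \<delta>_def)
  moreover have "(\<Sum>(u, v)\<in>I. \<bar>f v + g v - (f u + g u)\<bar>) < \<epsilon>"
    if I: "finite I" "\<forall>(u, v)\<in>I. a \<le> u \<and> u \<le> v \<and> v \<le> b"
      "disjoint_family_on (\<lambda>(u, v). {u<..<v}) I" "(\<Sum>(u, v)\<in>I. v - u) < \<delta>" for I
  proof -
    have "(\<Sum>(u, v)\<in>I. \<bar>f v + g v - (f u + g u)\<bar>) \<le> (\<Sum>(u, v)\<in>I. \<bar>f v - f u\<bar> + K * (v - u))"
    proof (rule sum_mono, clarify)
      fix u v assume "(u, v) \<in> I"
      then have "u \<le> v" using I(2) by auto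
      then show "\<bar>f v + g v - (f u + g u)\<bar> \<le> \<bar>f v - f u\<bar> + K * (v - u)"
        using lip[of v u] by linarith
    qed
    also have "\<dots> = (\<Sum>(u, v)\<in>I. \<bar>f v - f u\<bar>) + K * (\<Sum>(u, v)\<in>I. v - u)"
      by (simp add: case_prod_unfold sum.distrib sum_distrib_left)
    also have "\<dots> < \<epsilon> / 2 + K * (\<epsilon> / (2 * K))"
      using d[OF I(1-3)] I(4) \<open>K > 0\<close> unfolding \<delta>_def
      by (intro add_strict_mono mult_strict_left_mono) auto
    also have "\<dots> = \<epsilon>" using \<open>K > 0\<close> by simp
    finally show ?thesis .
  qed
  ultimately show "\<exists>\<delta>>0. \<forall>I. finite I \<and> (\<forall>(u, v)\<in>I. a \<le> u \<and> u \<le> v \<and> v \<le> b) \<and>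
        disjoint_family_on (\<lambda>(u, v). {u<..<v}) I \<and> (\<Sum>(u, v)\<in>I. v - u) < \<delta> \<longrightarrow>
        (\<Sum>(u, v)\<in>I. \<bar>f v + g v - (f u + g u)\<bar>) < \<epsilon>"
    by blast
qed

lemma abs_continuous_on_add_ramp:
  assumes "abs_continuous_on a b f"
  shows "abs_continuous_on a b (\<lambda>x. f x + e * ramp c x)"
proof (rule abs_continuous_on_add_Lipschitz[OF assms])
  \<comment> \<open>The summand 1 keeps the Lipschitz constant positive when
    \<open>e = 0\<close>.\<close>
  show "\<bar>e * ramp c v - e * ramp c u\<bar> \<le> (\<bar>e\<bar> + 1) * \<bar>v - u\<bar>" for u v
  proof -
    have "\<bar>e * ramp c v - e * ramp c u\<bar> = \<bar>e\<bar> * \<bar>ramp c v - ramp c u\<bar>"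
      by (simp add: right_diff_distrib[symmetric] abs_mult)
    also have "\<dots> \<le> (\<bar>e\<bar> + 1) * \<bar>v - u\<bar>"
      by (intro mult_mono) (auto simp: ramp_def max_def)
    finally show ?thesis .
  qed
qed simp

lemma deriv_add_ramp:
  assumes "f differentiable (at x)" "x \<noteq> c"
  shows "deriv (\<lambda>t. f t + e * ramp c t) x = deriv f x + e * of_bool (c < x)"
proof (rule DERIV_imp_deriv)
  have f: "(f has_real_derivative deriv f x) (at x)"
    using assms(1) by (metis DERIV_imp_deriv real_differentiable_def)
  have "(ramp c has_real_derivative of_bool (c < x)) (at x)"
  proof (cases "c < x")
    case True
    have "((\<lambda>t. t - c) has_real_derivative 1) (at x)" by (auto intro!: derivative_eq_intros)
    then have "(ramp c has_real_derivative 1) (at x)"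
      by (rule has_field_derivative_transform_within_open[of _ _ _ "{c<..}"]) (use True in \<open>auto simp: ramp_def\<close>)
    then show ?thesis using True by simp
  next
    case False
    have "((\<lambda>t. 0) has_real_derivative 0) (at x)" by simp
    then have "(ramp c has_real_derivative 0) (at x)"
      by (rule has_field_derivative_transform_within_open[of _ _ _ "{..<c}"]) (use False \<open>x \<noteq> c\<close> in \<open>auto simp: ramp_def\<close>)
    then show ?thesis using False by simp
  qed
  with f show "((\<lambda>t. f t + e * ramp c t) has_real_derivative deriv f x + e * of_bool (c < x)) (at x)"
    by (auto intro!: derivative_eq_intros)
qed

section \<open>Integrals of the weakly singular kernels beyond \<open>c\<close>\<close>

lemma has_integral_kernel_left:
  fixes r :: real
  assumes "0 < r" "a \<le> c" "a \<le> x"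
  shows "((\<lambda>t. (x - t) powr (r - 1) * of_bool (c < t)) has_integral max 0 (x - c) powr r / r) {a..x}"
proof (cases "c \<le> x")
  case True
  \<comment> \<open>The integrand may be unbounded at \<open>x\<close>, but its antiderivative is
    continuous up to \<open>x\<close> since \<open>r > 0\<close>.\<close>
  have "((\<lambda>t. (x - t) powr (r - 1)) has_integral - ((x - x) powr r / r) - - ((x - c) powr r / r)) {c..x}"
  proof (rule fundamental_theorem_of_calculus_interior[OF True])
    show "continuous_on {c..x} (\<lambda>t. - ((x - t) powr r / r))"
      using assms(1) by (intro continuous_intros continuous_on_powr') auto
    show "((\<lambda>t. - ((x - t) powr r / r)) has_vector_derivative (x - t) powr (r - 1)) (at t)"
      if "t \<in> {c<..<x}" for t
      unfolding has_real_derivative_iff_has_vector_derivative[symmetric]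
      using that assms(1) by (auto intro!: derivative_eq_intros simp: powr_diff)
  qed
  then have "((\<lambda>t. if t \<in> {c..x} then (x - t) powr (r - 1) else 0) has_integral max 0 (x - c) powr r / r) {a..x}"
    using True assms by (subst has_integral_restrict) auto
  then show ?thesis
    by (rule has_integral_spike_finite[of "{c}", rotated 2]) auto
next
  case False
  then have "((\<lambda>t. (x - t) powr (r - 1) * of_bool (c < t)) has_integral 0) {a..x}"
    by (intro has_integral_is_0) auto
  then show ?thesis using False by simp
qed

lemma has_integral_kernel_right:
  fixes r :: real
  assumes "0 < r" "c \<le> b" "x \<le> b"
  shows "((\<lambda>t. (t - x) powr (r - 1) * of_bool (c < t)) has_integral
           ((b - x) powr r - max 0 (c - x) powr r) / r) {x..b}"
proof -
  define m where "m = max c x"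
  have m: "m \<le> b" "x \<le> m" "c \<le> m" using assms by (auto simp: m_def)
  have "((\<lambda>t. (t - x) powr (r - 1)) has_integral (b - x) powr r / r - (m - x) powr r / r) {m..b}"
  proof (rule fundamental_theorem_of_calculus_interior[OF m(1)])
    show "continuous_on {m..b} (\<lambda>t. (t - x) powr r / r)"
      using assms(1) m by (intro continuous_intros continuous_on_powr') auto
    show "((\<lambda>t. (t - x) powr r / r) has_vector_derivative (t - x) powr (r - 1)) (at t)"
      if "t \<in> {m<..<b}" for t
      unfolding has_real_derivative_iff_has_vector_derivative[symmetric]
      using that assms(1) m by (auto intro!: derivative_eq_intros simp: powr_diff)
  qed
  moreover have "(b - x) powr r / r - (m - x) powr r / r = ((b - x) powr r - max 0 (c - x) powr r) / r"
    by (auto simp: m_def max_def diff_divide_distrib)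
  ultimately have "((\<lambda>t. if t \<in> {m..b} then (t - x) powr (r - 1) else 0) has_integral
      ((b - x) powr r - max 0 (c - x) powr r) / r) {x..b}"
    using m by (subst has_integral_restrict) auto
  then show ?thesis
    by (rule has_integral_spike_finite[of "{c, x}", rotated 2]) (auto simp: m_def)
qed

text \<open>Carries kernel integrals found by the fundamental theorem of calculus over to Lebesgue
  integrals: the sign of \<open>h\<close> turns gauge integrability into absolute integrability. The
  null set \<open>N\<close> absorbs the points where derivatives do not add.\<close>

lemma set_integral_add_spike:
  fixes u h g :: "real \<Rightarrow> real"
  assumes u: "set_integrable lebesgue S u" and h: "(h has_integral I) S" "\<And>t. t \<in> S \<Longrightarrow> 0 \<le> h t"
    and N: "negligible N" "\<And>t. t \<in> S - N \<Longrightarrow> g t = u t + e * h t"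
  shows "set_integrable lebesgue S g" "(LINT t:S|lebesgue. g t) = (LINT t:S|lebesgue. u t) + e * I"
proof -
  have habs: "h absolutely_integrable_on S"
    using h by (intro nonnegative_absolutely_integrable_1) auto
  have uh: "(\<lambda>t. u t + e * h t) absolutely_integrable_on S"
    using u habs by (intro set_integral_add(1) set_integrable_mult_right) auto
  show g: "set_integrable lebesgue S g"
    using uh N by (rule absolutely_integrable_spike)
  have "(u has_integral (LINT t:S|lebesgue. u t)) S"
    using u by (rule has_integral_set_lebesgue)
  then have "((\<lambda>t. u t + e * h t) has_integral (LINT t:S|lebesgue. u t) + e * I) S"
    using h(1) by (intro has_integral_add has_integral_mult_right)
  then have "(g has_integral (LINT t:S|lebesgue. u t) + e * I) S"
    using has_integral_spike[OF N(1), of S g "\<lambda>t. u t + e * h t"] N(2) by blast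
  then show "(LINT t:S|lebesgue. g t) = (LINT t:S|lebesgue. u t) + e * I"
    using has_integral_set_lebesgue[OF g] has_integral_unique by blast
qed

lemma comb_caputo_add_ramp:
  assumes "0 < \<alpha>" "\<alpha> < 1" "0 < \<beta>" "\<beta> < 1" "a \<le> c" "c \<le> b" and x: "x \<in> {a..b}"
    and ex: "comb_caputo_exists a b \<alpha> \<beta> \<gamma> f x"
    and N: "negligible N" "\<And>t. t \<in> {a..b} - N \<Longrightarrow> f differentiable (at t)"
  shows "comb_caputo_exists a b \<alpha> \<beta> \<gamma> (\<lambda>t. f t + e * ramp c t) x"
    and "comb_caputo a b \<alpha> \<beta> \<gamma> (\<lambda>t. f t + e * ramp c t) x =
           comb_caputo a b \<alpha> \<beta> \<gamma> f x + e * ramp_caputo b \<alpha> \<beta> \<gamma> c x"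
proof -
  let ?g = "\<lambda>t. f t + e * ramp c t"
  have N': "negligible (N \<union> {c})" using N(1) by auto
  have dg: "deriv ?g t = deriv f t + e * of_bool (c < t)" if "t \<in> {a..b} - (N \<union> {c})" for t
    using that N(2) by (intro deriv_add_ramp) auto
  have left: "RL_int_left_exists a (1 - \<alpha>) (deriv ?g) x \<and>
      caputo_left a \<alpha> ?g x = caputo_left a \<alpha> f x +
        e * (1 / Gamma (1 - \<alpha>) * (max 0 (x - c) powr (1 - \<alpha>) / (1 - \<alpha>)))"
    if "RL_int_left_exists a (1 - \<alpha>) (deriv f) x"
  proof -
    have kernel: "((\<lambda>t. (x - t) powr (1 - \<alpha> - 1) * of_bool (c < t)) has_integral
        max 0 (x - c) powr (1 - \<alpha>) / (1 - \<alpha>)) {a..x}"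
      using assms by (intro has_integral_kernel_left) auto
    have nonneg: "0 \<le> (x - t) powr (1 - \<alpha> - 1) * of_bool (c < t)" if "t \<in> {a..x}" for t by simp
    have spike: "(x - t) powr (1 - \<alpha> - 1) * deriv ?g t = (x - t) powr (1 - \<alpha> - 1) * deriv f t +
        e * ((x - t) powr (1 - \<alpha> - 1) * of_bool (c < t))" if "t \<in> {a..x} - (N \<union> {c})" for t
      using dg[of t] that x by (simp add: distrib_left)
    note int = set_integral_add_spike[OF that[unfolded RL_int_left_exists_def] kernel nonneg N' spike]
    from int show ?thesis
      unfolding RL_int_left_exists_def caputo_left_def RL_int_left_def by (simp add: distrib_left)
  qed
  have right: "RL_int_right_exists b (1 - \<beta>) (deriv ?g) x \<and>
      caputo_right b \<beta> ?g x = caputo_right b \<beta> f x -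
        e * (1 / Gamma (1 - \<beta>) * (((b - x) powr (1 - \<beta>) - max 0 (c - x) powr (1 - \<beta>)) / (1 - \<beta>)))"
    if "RL_int_right_exists b (1 - \<beta>) (deriv f) x"
  proof -
    have kernel: "((\<lambda>t. (t - x) powr (1 - \<beta> - 1) * of_bool (c < t)) has_integral
        ((b - x) powr (1 - \<beta>) - max 0 (c - x) powr (1 - \<beta>)) / (1 - \<beta>)) {x..b}"
      using assms by (intro has_integral_kernel_right) auto
    have nonneg: "0 \<le> (t - x) powr (1 - \<beta> - 1) * of_bool (c < t)" if "t \<in> {x..b}" for t by simp
    have spike: "(t - x) powr (1 - \<beta> - 1) * deriv ?g t = (t - x) powr (1 - \<beta> - 1) * deriv f t +
        e * ((t - x) powr (1 - \<beta> - 1) * of_bool (c < t))" if "t \<in> {x..b} - (N \<union> {c})" for t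
      using dg[of t] that x by (simp add: distrib_left)
    note int = set_integral_add_spike[OF that[unfolded RL_int_right_exists_def] kernel nonneg N' spike]
    from int show ?thesis
      unfolding RL_int_right_exists_def caputo_right_def RL_int_right_def by (simp add: distrib_left)
  qed
  show "comb_caputo_exists a b \<alpha> \<beta> \<gamma> ?g x"
    using ex left right unfolding comb_caputo_exists_def by blast
  \<comment> \<open>If \<open>\<gamma> = 0\<close> the left integral may diverge and the unscaled
    identity may fail, but both sides are then 0. The right part behaves in the same way at
    \<open>\<gamma> = 1\<close>.\<close>
  have "\<gamma> * caputo_left a \<alpha> ?g x = \<gamma> * (caputo_left a \<alpha> f x +
        e * (1 / Gamma (1 - \<alpha>) * (max 0 (x - c) powr (1 - \<alpha>) / (1 - \<alpha>))))"
    using ex left unfolding comb_caputo_exists_def by (cases "\<gamma> = 0") simp_all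
  moreover have "(1 - \<gamma>) * caputo_right b \<beta> ?g x = (1 - \<gamma>) * (caputo_right b \<beta> f x -
        e * (1 / Gamma (1 - \<beta>) * (((b - x) powr (1 - \<beta>) - max 0 (c - x) powr (1 - \<beta>)) / (1 - \<beta>))))"
    using ex right unfolding comb_caputo_exists_def by (cases "\<gamma> = 1") simp_all
  ultimately show "comb_caputo a b \<alpha> \<beta> \<gamma> ?g x =
      comb_caputo a b \<alpha> \<beta> \<gamma> f x + e * ramp_caputo b \<alpha> \<beta> \<gamma> c x"
    unfolding comb_caputo_def ramp_caputo_def by (simp add: algebra_simps)
qed

lemma continuous_on_ramp_caputo:
  assumes "\<alpha> < 1" "\<beta> < 1"
  shows "continuous_on {a..b} (ramp_caputo b \<alpha> \<beta> \<gamma> c)"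
proof -
  have 1: "continuous_on {a..b} (\<lambda>x. max 0 (x - c) powr (1 - \<alpha>))"
    by (rule continuous_on_powr') (use assms in \<open>auto intro!: continuous_intros\<close>)
  have 2: "continuous_on {a..b} (\<lambda>x. (b - x) powr (1 - \<beta>))"
    by (rule continuous_on_powr') (use assms in \<open>auto intro!: continuous_intros\<close>)
  have 3: "continuous_on {a..b} (\<lambda>x. max 0 (c - x) powr (1 - \<beta>))"
    by (rule continuous_on_powr') (use assms in \<open>auto intro!: continuous_intros\<close>)
  show ?thesis
    unfolding ramp_caputo_def[abs_def] divide_inverse
    by (intro continuous_on_diff continuous_on_mult continuous_on_const 1 2 3)
qed

lemma continuous_on_ramp: "continuous_on S (ramp c)"
  unfolding ramp_def[abs_def] by (intro continuous_intros)

section \<open>First variations along ramps\<close>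

text \<open>Uses c < t < b twice in the nontrivial case: t - c < b - c with the positive exponent
  \<open>r\<close>, and b - t < b - c with the negative exponent r - 1. The bound is free of
  \<open>c\<close>, as dominated convergence demands.\<close>

lemma ramp_powr_quotient_bound:
  fixes r :: real
  assumes "t < b" "c < b" "0 < r" "r < 1"
  shows "0 \<le> max 0 (t - c) powr r / (b - c)" "max 0 (t - c) powr r / (b - c) \<le> (b - t) powr (r - 1)"
proof -
  show "0 \<le> max 0 (t - c) powr r / (b - c)" using assms by simp
  show "max 0 (t - c) powr r / (b - c) \<le> (b - t) powr (r - 1)"
  proof (cases "t \<le> c")
    case False
    have "max 0 (t - c) powr r / (b - c) \<le> (b - c) powr r / (b - c)"
      using assms False by (intro divide_right_mono powr_mono2) auto
    also have "\<dots> = (b - c) powr (r - 1)" using assms by (simp add: powr_diff)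
    also have "\<dots> \<le> (b - t) powr (r - 1)"
      using assms False by (intro powr_mono2') auto
    finally show ?thesis .
  qed (use assms in simp)
qed

text \<open>Writing (b - t)^r as (b - t)(b - t)^(r-1), the case c \<le> t follows from b - t \<le> b
  - c. For c > t, (c - t)^r \<ge> (c - t)(b - t)^(r-1) because r - 1 is negative.\<close>

lemma powr_increment_quotient_bound:
  fixes r :: real
  assumes "t < b" "c < b" "0 < r" "r < 1"
  shows "0 \<le> ((b - t) powr r - max 0 (c - t) powr r) / (b - c)"
    "((b - t) powr r - max 0 (c - t) powr r) / (b - c) \<le> (b - t) powr (r - 1)"
proof -
  show "0 \<le> ((b - t) powr r - max 0 (c - t) powr r) / (b - c)"
    using assms by (intro divide_nonneg_pos) (auto intro!: powr_mono2)
  have bt: "(b - t) powr r = (b - t) * (b - t) powr (r - 1)"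
    using assms by (simp add: powr_diff)
  have "(b - t) powr r - max 0 (c - t) powr r \<le> (b - t) powr (r - 1) * (b - c)"
  proof (cases "c \<le> t")
    case True
    then have "(b - t) * (b - t) powr (r - 1) \<le> (b - c) * (b - t) powr (r - 1)"
      by (intro mult_right_mono) auto
    then show ?thesis using bt True assms by (simp add: mult.commute)
  next
    case False
    have "(c - t) * (b - t) powr (r - 1) \<le> (c - t) * (c - t) powr (r - 1)"
      using False assms by (intro mult_left_mono powr_mono2') auto
    also have "\<dots> = (c - t) powr r" using False by (simp add: powr_diff)
    finally show ?thesis using bt False by (simp add: algebra_simps)
  qed
  then show "((b - t) powr r - max 0 (c - t) powr r) / (b - c) \<le> (b - t) powr (r - 1)"
    using assms by (simp add: pos_divide_le_eq)
qed

text \<open>Once t < c n, the truncation is inactive and this is the difference quotient of s^r at s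
  = b - t with increment c n - b.\<close>

lemma tendsto_powr_increment_quotient:
  fixes r :: real
  assumes "t < b" "\<And>n. c n < b" "c \<longlonglongrightarrow> b"
  shows "(\<lambda>n. ((b - t) powr r - max 0 (c n - t) powr r) / (b - c n)) \<longlonglongrightarrow> r * (b - t) powr (r - 1)"
proof -
  have "((\<lambda>s. s powr r) has_real_derivative r * (b - t) powr (r - 1)) (at (b - t))"
    using assms by (auto intro!: derivative_eq_intros)
  then have lim: "((\<lambda>s. (s powr r - (b - t) powr r) / (s - (b - t))) \<longlongrightarrow> r * (b - t) powr (r - 1)) (at (b - t))"
    by (simp add: has_field_derivative_iff)
  have "filterlim (\<lambda>n. c n - t) (at (b - t)) sequentially"
    unfolding filterlim_at using assms(2,3)
    by (auto intro!: tendsto_intros simp: less_imp_neq always_eventually)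
  from filterlim_compose[OF lim this]
  have "(\<lambda>n. ((c n - t) powr r - (b - t) powr r) / (c n - t - (b - t))) \<longlonglongrightarrow> r * (b - t) powr (r - 1)" .
  moreover have "\<forall>\<^sub>F n in sequentially. t < c n" using order_tendstoD(1)[OF assms(3,1)] .
  then have "\<forall>\<^sub>F n in sequentially. ((c n - t) powr r - (b - t) powr r) / (c n - t - (b - t)) =
      ((b - t) powr r - max 0 (c n - t) powr r) / (b - c n)"
  proof eventually_elim
    case (elim n)
    then show ?case using assms(2)[of n]
      by (metis (no_types, opaque_lifting) diff_diff_eq2 diff_add_cancel max.absorb4 diff_gt_0_iff_gt minus_diff_eq minus_divide_divide add.commute)
  qed
  ultimately show ?thesis by (rule Lim_transform_eventually)
qed

lemma integrable_singular_kernel: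
  fixes a b r :: real
  assumes "0 < r" "a \<le> b"
  shows "(\<lambda>t. (b - t) powr (r - 1)) integrable_on {a..b}"
proof -
  have "(\<lambda>t. (b - t) powr (r - 1) * of_bool (a < t)) integrable_on {a..b}"
    using has_integral_kernel_left[OF assms(1) order_refl assms(2)] by (auto simp: integrable_on_def)
  then show ?thesis
    by (rule integrable_spike_finite[of "{a}", rotated 2]) auto
qed

text \<open>At a fixed t < b, the ramp and its left Caputo part are zero as soon as t < c n. The
  quotient of the right part tends to a multiple of (b - t)^(-\<beta>), and the factor 1 - \<beta>
  produced by differentiation cancels the one in \<open>B\<close>.\<close>

lemma tendsto_ramp_variation:
  fixes a b :: real
  assumes ab: "a < b" and \<alpha>: "0 < \<alpha>" "\<alpha> < 1" and \<beta>: "0 < \<beta>" "\<beta> < 1" and \<gamma>: "0 \<le> \<gamma>" "\<gamma> \<le> 1"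
    and \<psi>: "continuous_on {a..b} \<psi>" and \<phi>: "continuous_on {a..b} \<phi>"
    and c: "\<And>n. a \<le> c n" "\<And>n. c n < b" "c \<longlonglongrightarrow> b"
  shows "(\<lambda>n. integral {a..b} (\<lambda>t. ramp (c n) t * \<psi> t + ramp_caputo b \<alpha> \<beta> \<gamma> (c n) t * \<phi> t) / (b - c n))
           \<longlonglongrightarrow> - (1 - \<gamma>) * RL_int_left a (1 - \<beta>) \<phi> b"
proof -
  let ?R = "ramp_caputo b \<alpha> \<beta> \<gamma>"
  \<comment> \<open>At t = b the quotient may contain (b - c n)^(-\<alpha>), which is unbounded in
    \<open>n\<close>, while the dominating function below equals only \<open>M1\<close> there
    because \<open>0 powr _ = 0\<close>. Resetting this single point leaves the integrals
    unchanged.\<close>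
  define F where "F n t = (if t = b then 0 else (ramp (c n) t * \<psi> t + ?R (c n) t * \<phi> t) / (b - c n))" for n t
  define g where "g = (1 - \<gamma>) / Gamma (1 - \<beta>)"
  define G where "G t = (if t = b then 0 else - g * (b - t) powr (1 - \<beta> - 1) * \<phi> t)" for t
  define A where "A = \<gamma> / Gamma (1 - \<alpha>) / (1 - \<alpha>)"
  define B where "B = g / (1 - \<beta>)"
  have nonneg: "g \<ge> 0" "A \<ge> 0" "B \<ge> 0"
    using Gamma_real_pos[of "1 - \<alpha>"] Gamma_real_pos[of "1 - \<beta>"] \<alpha> \<beta> \<gamma>
    by (auto simp: g_def A_def B_def intro!: divide_nonneg_nonneg less_imp_le)
  have R_eq: "?R s t = A * max 0 (t - s) powr (1 - \<alpha>) - B * ((b - t) powr (1 - \<beta>) - max 0 (s - t) powr (1 - \<beta>))" for s t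
    by (simp add: ramp_caputo_def A_def B_def g_def)
  obtain M1 where M1: "\<And>t. t \<in> {a..b} \<Longrightarrow> \<bar>\<psi> t\<bar> \<le> M1"
    using compact_continuous_image[OF \<psi> compact_Icc] compact_imp_bounded
    by (metis bounded_iff image_eqI real_norm_def)
  obtain M2 where M2: "\<And>t. t \<in> {a..b} \<Longrightarrow> \<bar>\<phi> t\<bar> \<le> M2"
    using compact_continuous_image[OF \<phi> compact_Icc] compact_imp_bounded
    by (metis bounded_iff image_eqI real_norm_def)
  have M: "M1 \<ge> 0" "M2 \<ge> 0" using M1[of a] M2[of a] ab by auto
  define H where "H t = M1 + (A * (b - t) powr (1 - \<alpha> - 1) + B * (b - t) powr (1 - \<beta> - 1)) * M2" for t
  have F_int: "F n integrable_on {a..b}" and F_eq: "integral {a..b} (F n) =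
      integral {a..b} (\<lambda>t. ramp (c n) t * \<psi> t + ?R (c n) t * \<phi> t) / (b - c n)" for n
  proof -
    have "continuous_on {a..b} (\<lambda>t. (ramp (c n) t * \<psi> t + ?R (c n) t * \<phi> t) / (b - c n))"
      unfolding divide_inverse
      by (intro continuous_on_mult continuous_on_add continuous_on_const \<psi> \<phi> continuous_on_ramp
          continuous_on_ramp_caputo \<alpha> \<beta>)
    then have "(\<lambda>t. (ramp (c n) t * \<psi> t + ?R (c n) t * \<phi> t) / (b - c n)) integrable_on {a..b}"
      by (rule integrable_continuous_real)
    then show "F n integrable_on {a..b}"
      by (rule integrable_spike_finite[of "{b}", rotated 2]) (auto simp: F_def)
    have "integral {a..b} (F n) = integral {a..b} (\<lambda>t. (ramp (c n) t * \<psi> t + ?R (c n) t * \<phi> t) / (b - c n))"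
      by (rule integral_spike[of "{b}"]) (auto simp: F_def)
    then show "integral {a..b} (F n) =
      integral {a..b} (\<lambda>t. ramp (c n) t * \<psi> t + ?R (c n) t * \<phi> t) / (b - c n)" by simp
  qed
  have "(\<lambda>n. integral {a..b} (F n)) \<longlonglongrightarrow> integral {a..b} G"
  proof (rule dominated_convergence(2)[of _ _ H])
    show "H integrable_on {a..b}"
      unfolding H_def[abs_def] using integrable_singular_kernel[of "1 - \<alpha>" a b] integrable_singular_kernel[of "1 - \<beta>" a b] \<alpha> \<beta> ab
      by (intro integrable_add integrable_on_mult_left integrable_on_mult_right) auto
    show "F n integrable_on {a..b}" for n by (rule F_int)
    show "norm (F n t) \<le> H t" if t: "t \<in> {a..b}" for n t
    proof (cases "t = b")
      case True
      have "0 \<le> H t" unfolding H_def using M nonneg by (intro add_nonneg_nonneg mult_nonneg_nonneg) auto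
      then show ?thesis by (simp add: F_def True)
    next
      case False
      then have "t < b" using t by simp
      let ?p = "max 0 (t - c n) powr (1 - \<alpha>) / (b - c n)"
      let ?q = "((b - t) powr (1 - \<beta>) - max 0 (c n - t) powr (1 - \<beta>)) / (b - c n)"
      have p: "0 \<le> ?p" "?p \<le> (b - t) powr (1 - \<alpha> - 1)"
        using ramp_powr_quotient_bound[of t b "c n" "1 - \<alpha>"] \<open>t < b\<close> c(2) \<alpha> by auto
      have q: "0 \<le> ?q" "?q \<le> (b - t) powr (1 - \<beta> - 1)"
        using powr_increment_quotient_bound[of t b "c n" "1 - \<beta>"] \<open>t < b\<close> c(2) \<beta> by auto
      have "F n t = ramp (c n) t / (b - c n) * \<psi> t + (A * ?p - B * ?q) * \<phi> t"
      proof -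
        have "(x * z + (A * P - B * Q) * w) / d = x / d * z + (A * (P / d) - B * (Q / d)) * w"
          for x z P Q w d :: real
          by (simp add: divide_inverse algebra_simps)
        then show ?thesis using False unfolding F_def R_eq by simp
      qed
      also have "\<bar>\<dots>\<bar> \<le> \<bar>ramp (c n) t / (b - c n)\<bar> * \<bar>\<psi> t\<bar> + \<bar>A * ?p - B * ?q\<bar> * \<bar>\<phi> t\<bar>"
        by (rule order_trans[OF abs_triangle_ineq]) (simp add: abs_mult)
      also have "\<dots> \<le> 1 * M1 + (A * (b - t) powr (1 - \<alpha> - 1) + B * (b - t) powr (1 - \<beta> - 1)) * M2"
      proof (intro add_mono mult_mono M1 M2 t)
        show "\<bar>ramp (c n) t / (b - c n)\<bar> \<le> 1" using c(2)[of n] \<open>t < b\<close> by (simp add: ramp_def)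
        have "A * ?p \<le> A * (b - t) powr (1 - \<alpha> - 1)" "B * ?q \<le> B * (b - t) powr (1 - \<beta> - 1)"
          "0 \<le> A * ?p" "0 \<le> B * ?q"
          by (intro mult_left_mono mult_nonneg_nonneg p q nonneg)+
        then show "\<bar>A * ?p - B * ?q\<bar> \<le> A * (b - t) powr (1 - \<alpha> - 1) + B * (b - t) powr (1 - \<beta> - 1)"
          by linarith
      qed (use M nonneg in auto)
      finally show ?thesis by (simp add: H_def)
    qed
    show "(\<lambda>n. F n t) \<longlonglongrightarrow> G t" if t: "t \<in> {a..b}" for t
    proof (cases "t = b")
      case False
      then have "t < b" using t by simp
      have ev: "\<forall>\<^sub>F n in sequentially. t < c n" using order_tendstoD(1)[OF c(3) \<open>t < b\<close>] .
      have lim: "(\<lambda>n. - B * (((b - t) powr (1 - \<beta>) - max 0 (c n - t) powr (1 - \<beta>)) / (b - c n)) * \<phi> t)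
          \<longlonglongrightarrow> - B * ((1 - \<beta>) * (b - t) powr (1 - \<beta> - 1)) * \<phi> t"
        by (intro tendsto_mult tendsto_const tendsto_powr_increment_quotient \<open>t < b\<close> c)
      have eqG: "- B * ((1 - \<beta>) * (b - t) powr (1 - \<beta> - 1)) * \<phi> t = G t"
        using \<beta> False by (simp add: G_def B_def)
      from ev have evF: "\<forall>\<^sub>F n in sequentially.
          - B * (((b - t) powr (1 - \<beta>) - max 0 (c n - t) powr (1 - \<beta>)) / (b - c n)) * \<phi> t = F n t"
        by eventually_elim (use False in \<open>simp add: F_def R_eq ramp_def\<close>)
      show ?thesis using Lim_transform_eventually[OF lim evF] unfolding eqG .
    qed (simp add: F_def G_def)
  qed
  moreover have "integral {a..b} G = - (1 - \<gamma>) * RL_int_left a (1 - \<beta>) \<phi> b"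
  proof -
    have "(\<lambda>t. (b - t) powr (1 - \<beta> - 1)) absolutely_integrable_on {a..b}"
      using integrable_singular_kernel[of "1 - \<beta>" a b] \<beta> ab by (intro nonnegative_absolutely_integrable_1) auto
    moreover have "\<phi> \<in> borel_measurable (lebesgue_on {a..b})"
      using \<phi> by (intro continuous_imp_measurable_on_sets_lebesgue) auto
    moreover have "bounded (\<phi> ` {a..b})"
      using compact_continuous_image[OF \<phi> compact_Icc] by (rule compact_imp_bounded)
    ultimately have "(\<lambda>t. \<phi> t * (b - t) powr (1 - \<beta> - 1)) absolutely_integrable_on {a..b}"
      by (intro absolutely_integrable_bounded_measurable_product_real) auto
    then have "set_integrable lebesgue {a..b} (\<lambda>t. (b - t) powr (1 - \<beta> - 1) * \<phi> t)"
      by (simp add: mult.commute)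
    then have "(LINT t:{a..b}|lebesgue. (b - t) powr (1 - \<beta> - 1) * \<phi> t) =
        integral {a..b} (\<lambda>t. (b - t) powr (1 - \<beta> - 1) * \<phi> t)"
      by (rule set_lebesgue_integral_eq_integral)
    moreover have "integral {a..b} G = integral {a..b} (\<lambda>t. - g * ((b - t) powr (1 - \<beta> - 1) * \<phi> t))"
      by (rule integral_spike[of "{b}"]) (auto simp: G_def)
    ultimately show ?thesis
      unfolding RL_int_left_def integral_mult_right by (simp add: g_def divide_inverse algebra_simps)
  qed
  ultimately show ?thesis by (simp add: F_eq)
qed

section \<open>Differentiation of the functional along a line\<close>

lemma has_real_derivative_along_line:
  fixes L :: "'a::real_normed_vector \<Rightarrow> real"
  assumes "\<And>p. p \<in> S \<Longrightarrow> (L has_derivative blinfun_apply (L' p)) (at p within S)"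
    and "\<And>e. p + e *\<^sub>R d \<in> S"
  shows "((\<lambda>e. L (p + e *\<^sub>R d)) has_real_derivative blinfun_apply (L' (p + e *\<^sub>R d)) d) (at e)"
proof -
  have "((\<lambda>e. p + e *\<^sub>R d) has_derivative (\<lambda>h. h *\<^sub>R d)) (at e)"
    using has_derivative_add[OF has_derivative_const has_derivative_scaleR_left[OF has_derivative_ident]] by simp
  moreover have "(L has_derivative blinfun_apply (L' (p + e *\<^sub>R d))) (at (p + e *\<^sub>R d) within range (\<lambda>e. p + e *\<^sub>R d))"
    by (rule has_derivative_subset[OF assms(1)[OF assms(2)]]) (use assms(2) in auto)
  ultimately have "((\<lambda>e. L (p + e *\<^sub>R d)) has_derivative (\<lambda>h. blinfun_apply (L' (p + e *\<^sub>R d)) (h *\<^sub>R d))) (at e)"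
    by (rule has_derivative_in_compose)
  then show ?thesis
    by (simp add: has_field_derivative_def blinfun.scaleR_right mult_commute_abs)
qed

text \<open>The variation leaves the time coordinate fixed, so its line stays in the strip and the
  derivative of \<open>L\<close> within the strip gives a full derivative in \<open>e\<close>, even
  at t = a and t = b. Continuity of \<open>L'\<close> permits differentiation under the
  integral.\<close>

lemma has_real_derivative_integral_variation:
  fixes L :: "real \<times> 'a::real_normed_vector \<Rightarrow> real" and q w :: "real \<Rightarrow> 'a"
  assumes L': "\<And>p. p \<in> {a..b} \<times> UNIV \<Longrightarrow> (L has_derivative blinfun_apply (L' p)) (at p within {a..b} \<times> UNIV)"
    and cont: "continuous_on ({a..b} \<times> UNIV) L'"
    and q: "continuous_on {a..b} q" and w: "continuous_on {a..b} w"
  shows "((\<lambda>e. integral {a..b} (\<lambda>t. L (t, q t + e *\<^sub>R w t))) has_real_derivative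
           integral {a..b} (\<lambda>t. blinfun_apply (L' (t, q t)) (0, w t))) (at 0)"
    and "continuous_on {a..b} (\<lambda>t. L (t, q t + e *\<^sub>R w t))"
proof -
  have contL: "continuous_on ({a..b} \<times> UNIV) L"
    by (rule has_derivative_continuous_on[OF L'])
  show int: "continuous_on {a..b} (\<lambda>t. L (t, q t + e *\<^sub>R w t))" for e
    by (rule continuous_on_compose2[OF contL]) (auto intro!: continuous_intros q w)
  have "((\<lambda>e. integral (cbox a b) (\<lambda>t. L (t, q t + e *\<^sub>R w t))) has_real_derivative
      integral (cbox a b) (\<lambda>t. blinfun_apply (L' (t, q t + 0 *\<^sub>R w t)) (0, w t))) (at 0 within UNIV)"
  proof (rule leibniz_rule_field_derivative[where U = UNIV and
        fx = "\<lambda>e t. blinfun_apply (L' (t, q t + e *\<^sub>R w t)) (0, w t)"])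
    show "((\<lambda>e. L (t, q t + e *\<^sub>R w t)) has_real_derivative
        blinfun_apply (L' (t, q t + e *\<^sub>R w t)) (0, w t)) (at e within UNIV)" if "t \<in> cbox a b" for e t
      using has_real_derivative_along_line[OF L', where p = "(t, q t)" and d = "(0, w t)" and e = e] that by simp
    show "(\<lambda>t. L (t, q t + e *\<^sub>R w t)) integrable_on cbox a b" for e
      using int[of e] by (simp add: integrable_continuous_real)
    have "continuous_on (UNIV \<times> {a..b}) (\<lambda>z. q (snd z))" "continuous_on (UNIV \<times> {a..b}) (\<lambda>z. w (snd z))"
      by (auto intro!: continuous_on_compose2[OF q] continuous_on_compose2[OF w] continuous_intros)
    then have "continuous_on (UNIV \<times> {a..b}) (\<lambda>z. blinfun_apply (L' (snd z, q (snd z) + fst z *\<^sub>R w (snd z))) (0, w (snd z)))"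
      by (intro blinfun.continuous_on continuous_on_compose2[OF cont] continuous_intros) auto
    then show "continuous_on (UNIV \<times> cbox a b) (\<lambda>(e, t). blinfun_apply (L' (t, q t + e *\<^sub>R w t)) (0, w t))"
      by (simp add: case_prod_unfold)
  qed auto
  then show "((\<lambda>e. integral {a..b} (\<lambda>t. L (t, q t + e *\<^sub>R w t))) has_real_derivative
           integral {a..b} (\<lambda>t. blinfun_apply (L' (t, q t)) (0, w t))) (at 0)" by simp
qed

section \<open>The transversality condition\<close>

lemma D_space_add_ramp:
  fixes y :: "real \<Rightarrow> real^'n" and l :: 'n and e :: real
  assumes \<alpha>: "\<forall>i. 0 < \<alpha> $ i \<and> \<alpha> $ i < 1" and \<beta>: "\<forall>i. 0 < \<beta> $ i \<and> \<beta> $ i < 1"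
    and c: "a \<le> c" "c \<le> b" and y: "y \<in> D_space a b \<alpha> \<beta> \<gamma>"
  defines "z \<equiv> \<lambda>x. y x + (e * ramp c x) *\<^sub>R axis l 1"
  shows "x \<in> {a..b} \<Longrightarrow> comb_caputo_vec a b \<alpha> \<beta> \<gamma> z x = comb_caputo_vec a b \<alpha> \<beta> \<gamma> y x +
           (e * ramp_caputo b (\<alpha> $ l) (\<beta> $ l) (\<gamma> $ l) c x) *\<^sub>R axis l 1"
    and "z \<in> D_space a b \<alpha> \<beta> \<gamma>"
proof -
  have y_ac: "abs_continuous_on a b (\<lambda>t. y t $ i)"
    and y_ex: "x \<in> {a..b} \<Longrightarrow> comb_caputo_exists a b (\<alpha> $ i) (\<beta> $ i) (\<gamma> $ i) (\<lambda>t. y t $ i) x"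
    and y_cont: "continuous_on {a..b} (comb_caputo_vec a b \<alpha> \<beta> \<gamma> y)" for i x
    using y by (auto simp: D_space_def)
  have z_l: "(\<lambda>t. z t $ l) = (\<lambda>t. y t $ l + e * ramp c t)"
    by (simp add: z_def)
  have z_i: "(\<lambda>t. z t $ i) = (\<lambda>t. y t $ i)" if "i \<noteq> l" for i
    using that by (simp add: z_def axis_def)
  obtain N where N: "negligible N" "\<And>t. t \<in> {a..b} - N \<Longrightarrow> (\<lambda>t. y t $ l) differentiable (at t)"
    using abs_continuous_on_differentiable_AE[OF y_ac] by blast
  note ramp_l = comb_caputo_add_ramp[of "\<alpha> $ l" "\<beta> $ l" a c b _ "\<gamma> $ l" "\<lambda>t. y t $ l", OF _ _ _ _ c _ y_ex N]
  show eq: "comb_caputo_vec a b \<alpha> \<beta> \<gamma> z x = comb_caputo_vec a b \<alpha> \<beta> \<gamma> y x +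
      (e * ramp_caputo b (\<alpha> $ l) (\<beta> $ l) (\<gamma> $ l) c x) *\<^sub>R axis l 1" if "x \<in> {a..b}" for x
    unfolding vec_eq_iff
  proof
    fix i
    show "comb_caputo_vec a b \<alpha> \<beta> \<gamma> z x $ i = (comb_caputo_vec a b \<alpha> \<beta> \<gamma> y x +
      (e * ramp_caputo b (\<alpha> $ l) (\<beta> $ l) (\<gamma> $ l) c x) *\<^sub>R axis l 1) $ i"
    proof (cases "i = l")
      case True
      then show ?thesis
        using ramp_l(2)[of x e] that \<alpha> \<beta> by (simp add: comb_caputo_vec_def z_l)
    next
      case False
      then show ?thesis by (simp add: comb_caputo_vec_def z_i axis_def)
    qed
  qed
  have "abs_continuous_on a b (\<lambda>t. z t $ i)" for i
    using y_ac[of i] abs_continuous_on_add_ramp[OF y_ac[of l]] z_l z_i by (cases "i = l") auto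
  moreover have "comb_caputo_exists a b (\<alpha> $ i) (\<beta> $ i) (\<gamma> $ i) (\<lambda>t. z t $ i) x" if "x \<in> {a..b}" for i x
  proof (cases "i = l")
    case True
    then show ?thesis using ramp_l(1)[of x e] that \<alpha> \<beta> by (simp add: z_l)
  next
    case False
    then show ?thesis using y_ex[OF that] by (simp add: z_i)
  qed
  moreover have "continuous_on {a..b} (comb_caputo_vec a b \<alpha> \<beta> \<gamma> z)"
  proof -
    have "continuous_on {a..b} (ramp_caputo b (\<alpha> $ l) (\<beta> $ l) (\<gamma> $ l) c)"
      using \<alpha> \<beta> by (intro continuous_on_ramp_caputo) auto
    then have "continuous_on {a..b} (\<lambda>x. comb_caputo_vec a b \<alpha> \<beta> \<gamma> y x +
        (e * ramp_caputo b (\<alpha> $ l) (\<beta> $ l) (\<gamma> $ l) c x) *\<^sub>R axis l 1)"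
      by (intro continuous_on_add continuous_on_scaleR continuous_on_mult continuous_on_const y_cont)
    then show ?thesis by (rule continuous_on_eq) (simp add: eq)
  qed
  ultimately show "z \<in> D_space a b \<alpha> \<beta> \<gamma>" by (simp add: D_space_def)
qed

text \<open>The base point from which \<open>D_space_add_ramp\<close> yields the combined derivative
  of a pure ramp, needed for its norm.\<close>

lemma zero_in_D_space:
  shows "(\<lambda>x. 0) \<in> D_space a b \<alpha> \<beta> \<gamma>" and "comb_caputo_vec a b \<alpha> \<beta> \<gamma> (\<lambda>x. 0) = (\<lambda>x. 0)"
proof -
  show eq: "comb_caputo_vec a b \<alpha> \<beta> \<gamma> (\<lambda>x. 0) = (\<lambda>x. 0)"
    by (rule ext) (simp add: comb_caputo_vec_def comb_caputo_def caputo_left_def caputo_right_def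
        RL_int_left_def RL_int_right_def vec_eq_iff)
  have "abs_continuous_on a b (\<lambda>t. 0)"
    by (auto simp: abs_continuous_on_def intro: exI[of _ 1])
  then show "(\<lambda>x. 0) \<in> D_space a b \<alpha> \<beta> \<gamma>"
    by (simp add: D_space_def eq comb_caputo_exists_def RL_int_left_exists_def RL_int_right_exists_def
        set_integrable_def)
qed

text \<open>Puts the perturbed function into the \<delta>-ball for small \<open>e\<close>. The
  constant may depend on \<open>c\<close>, since \<open>c\<close> is fixed while \<open>e\<close>
  varies.\<close>

lemma norm_1_inf_ramp_le:
  fixes \<nu> :: "real^'n \<Rightarrow> real"
  assumes \<nu>: "is_norm \<nu>" and ab: "a < b"
    and \<alpha>: "\<forall>i. 0 < \<alpha> $ i \<and> \<alpha> $ i < 1" and \<beta>: "\<forall>i. 0 < \<beta> $ i \<and> \<beta> $ i < 1"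
    and c: "a \<le> c" "c \<le> b"
  obtains C where "C > 0"
    "\<And>e. norm_1_inf \<nu> a b \<alpha> \<beta> \<gamma> (\<lambda>x. (e * ramp c x) *\<^sub>R axis l 1) \<le> \<bar>e\<bar> * C"
proof -
  let ?u = "axis l 1 :: real^'n"
  let ?R = "ramp_caputo b (\<alpha> $ l) (\<beta> $ l) (\<gamma> $ l) c"
  have u: "0 \<le> \<nu> ?u" and scale: "\<nu> (s *\<^sub>R ?u) = \<bar>s\<bar> * \<nu> ?u" for s
    using \<nu> by (auto simp: is_norm_def)
  have "continuous_on {a..b} ?R"
    using \<alpha> \<beta> by (intro continuous_on_ramp_caputo) auto
  then have "bounded (?R ` {a..b})"
    using compact_continuous_image compact_imp_bounded by blast
  then obtain B where "B > 0" and B: "\<And>x. x \<in> {a..b} \<Longrightarrow> \<bar>?R x\<bar> \<le> B"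
    unfolding bounded_pos by auto
  have "norm_1_inf \<nu> a b \<alpha> \<beta> \<gamma> (\<lambda>x. (e * ramp c x) *\<^sub>R ?u) \<le> \<bar>e\<bar> * ((b - a) * \<nu> ?u + B * \<nu> ?u + 1)" for e
  proof -
    have comb: "comb_caputo_vec a b \<alpha> \<beta> \<gamma> (\<lambda>x. (e * ramp c x) *\<^sub>R ?u) x = (e * ?R x) *\<^sub>R ?u"
      if "x \<in> {a..b}" for x
      using D_space_add_ramp(1)[OF \<alpha> \<beta> c zero_in_D_space(1) that, of \<gamma> e l] by (simp add: zero_in_D_space(2))
    have "(SUP x\<in>{a..b}. \<nu> ((e * ramp c x) *\<^sub>R ?u)) \<le> \<bar>e\<bar> * ((b - a) * \<nu> ?u)"
    proof (rule cSUP_least)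
      show "\<nu> ((e * ramp c x) *\<^sub>R ?u) \<le> \<bar>e\<bar> * ((b - a) * \<nu> ?u)" if "x \<in> {a..b}" for x
        unfolding scale abs_mult mult.assoc
        using that c u by (intro mult_left_mono mult_right_mono) (auto simp: ramp_def)
    qed (use ab in auto)
    moreover have "(SUP x\<in>{a..b}. \<nu> (comb_caputo_vec a b \<alpha> \<beta> \<gamma> (\<lambda>x. (e * ramp c x) *\<^sub>R ?u) x))
        \<le> \<bar>e\<bar> * (B * \<nu> ?u)"
    proof (rule cSUP_least)
      show "\<nu> (comb_caputo_vec a b \<alpha> \<beta> \<gamma> (\<lambda>x. (e * ramp c x) *\<^sub>R ?u) x) \<le> \<bar>e\<bar> * (B * \<nu> ?u)"
        if "x \<in> {a..b}" for x
        unfolding comb[OF that] scale abs_mult mult.assoc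
        using B[OF that] u by (intro mult_left_mono mult_right_mono) auto
    qed (use ab in auto)
    ultimately show ?thesis
      unfolding norm_1_inf_def by (simp add: algebra_simps)
  qed
  moreover have "(b - a) * \<nu> ?u + B * \<nu> ?u + 1 > 0"
    using ab u \<open>B > 0\<close> by (intro add_nonneg_pos add_nonneg_nonneg mult_nonneg_nonneg) auto
  ultimately show thesis using that by blast
qed

text \<open>Setting component \<open>l\<close> to \<open>s\<close> is motion from \<open>v\<close>
  along \<open>axis l 1\<close> by \<open>s - v $ l\<close>, so the partial derivative is
  \<open>L'\<close> in that direction.\<close>

lemma partial_frac_eq:
  fixes L :: "real \<times> (real^'n) \<times> (real^'n) \<Rightarrow> real"
  assumes L': "\<And>p. p \<in> {a..b} \<times> UNIV \<Longrightarrow> (L has_derivative blinfun_apply (L' p)) (at p within {a..b} \<times> UNIV)"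
    and x: "x \<in> {a..b}"
  shows "partial_frac l L (x, y, v) = blinfun_apply (L' (x, y, v)) (0, 0, axis l 1)"
proof -
  have "(\<chi> i. if i = l then s else v $ i) = v + (s - v $ l) *\<^sub>R axis l 1" for s
    by (simp add: vec_eq_iff axis_def)
  then have eq: "L (x, y, \<chi> i. if i = l then s else v $ i) =
      L ((x, y, v) + (s - v $ l) *\<^sub>R (0, 0, axis l 1))" for s by simp
  have "((\<lambda>e. L ((x, y, v) + e *\<^sub>R (0, 0, axis l 1))) has_real_derivative
      blinfun_apply (L' ((x, y, v) + (v $ l - v $ l) *\<^sub>R (0, 0, axis l 1))) (0, 0, axis l 1)) (at (v $ l - v $ l))"
    by (rule has_real_derivative_along_line[OF L']) (use x in auto)
  moreover have "((\<lambda>s. s - v $ l) has_real_derivative 1) (at (v $ l))"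
    by (auto intro!: derivative_eq_intros)
  ultimately have "((\<lambda>s. L ((x, y, v) + (s - v $ l) *\<^sub>R (0, 0, axis l 1))) has_real_derivative
      blinfun_apply (L' ((x, y, v) + (v $ l - v $ l) *\<^sub>R (0, 0, axis l 1))) (0, 0, axis l 1) * 1) (at (v $ l))"
    by (rule DERIV_chain2)
  then show ?thesis
    unfolding partial_frac_def prod.case eq by (simp add: DERIV_imp_deriv)
qed

text \<open>The integrand is zero at its only point because \<open>0 powr _ = 0\<close>. This
  removes the \<open>\<gamma> $ l\<close> term from \<Lambda>.\<close>

lemma RL_int_right_endpoint: "RL_int_right b r f b = 0"
proof -
  have "(LINT t:{b..b}|lebesgue. (t - b) powr (r - 1) * f t) = (LINT t:{b..b}|lebesgue. 0)"
    by (rule set_lebesgue_integral_cong) auto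
  then show ?thesis by (simp add: RL_int_right_def)
qed

lemma RL_int_left_cong:
  assumes "\<And>t. t \<in> {a..x} \<Longrightarrow> f t = g t"
  shows "RL_int_left a r f x = RL_int_left a r g x"
proof -
  have "(LINT t:{a..x}|lebesgue. (x - t) powr (r - 1) * f t) = (LINT t:{a..x}|lebesgue. (x - t) powr (r - 1) * g t)"
    by (rule set_lebesgue_integral_cong) (use assms in auto)
  then show ?thesis by (simp add: RL_int_left_def)
qed

theorem mainTheorem3:
  fixes a b :: real
    and \<alpha> \<beta> \<gamma> :: "real^'n"
    and \<nu> :: "real^'n \<Rightarrow> real"
    and L :: "real \<times> (real^'n) \<times> (real^'n) \<Rightarrow> real"
    and ya yb :: "real^'n"
    and l :: 'n
    and y :: "real \<Rightarrow> real^'n"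
    and \<Lambda> :: real
  assumes "a < b"
    and "\<forall>i. 0 < \<alpha> $ i \<and> \<alpha> $ i < 1"
    and "\<forall>i. 0 < \<beta> $ i \<and> \<beta> $ i < 1"
    and "\<forall>i. 0 \<le> \<gamma> $ i \<and> \<gamma> $ i \<le> 1"
    and "is_norm \<nu>"
    and "C1_on ({a..b} \<times> UNIV) L"
    and "local_minimizer \<nu> a b \<alpha> \<beta> \<gamma> (J_functional a b \<alpha> \<beta> \<gamma> L)
           {z \<in> D_space a b \<alpha> \<beta> \<gamma>.
              z a = ya \<and> (\<forall>i. i \<noteq> l \<longrightarrow> z b $ i = yb $ i) \<and> z b $ l \<le> yb $ l} y"
    and "\<Lambda> = \<gamma> $ l * RL_int_right b (1 - \<alpha> $ l)
                      (\<lambda>x. partial_frac l L (bracket a b \<alpha> \<beta> \<gamma> y x)) b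
            - (1 - \<gamma> $ l) * RL_int_left a (1 - \<beta> $ l)
                      (\<lambda>x. partial_frac l L (bracket a b \<alpha> \<beta> \<gamma> y x)) b"
  shows "\<Lambda> \<le> 0 \<and> y b $ l \<le> yb $ l \<and> (y b $ l - yb $ l) * \<Lambda> = 0"
proof -
  note ab = \<open>a < b\<close> and \<alpha> = assms(2) and \<beta> = assms(3) and \<gamma> = assms(4)
  define v where "v = comb_caputo_vec a b \<alpha> \<beta> \<gamma> y"
  define u where "u = (axis l 1 :: real^'n)"
  define R where "R = ramp_caputo b (\<alpha> $ l) (\<beta> $ l) (\<gamma> $ l)"
  obtain \<delta> where y: "y \<in> D_space a b \<alpha> \<beta> \<gamma>" "y a = ya" "\<And>i. i \<noteq> l \<Longrightarrow> y b $ i = yb $ i" "y b $ l \<le> yb $ l"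
    and "\<delta> > 0" and min: "\<And>z. z \<in> D_space a b \<alpha> \<beta> \<gamma> \<Longrightarrow> z a = ya \<Longrightarrow> (\<forall>i. i \<noteq> l \<longrightarrow> z b $ i = yb $ i) \<Longrightarrow>
        z b $ l \<le> yb $ l \<Longrightarrow> norm_1_inf \<nu> a b \<alpha> \<beta> \<gamma> (\<lambda>x. z x - y x) < \<delta> \<Longrightarrow>
        J_functional a b \<alpha> \<beta> \<gamma> L y \<le> J_functional a b \<alpha> \<beta> \<gamma> L z"
    using assms(7) unfolding local_minimizer_def by auto
  obtain L' where L': "\<And>p. p \<in> {a..b} \<times> UNIV \<Longrightarrow>
        (L has_derivative blinfun_apply (L' p)) (at p within {a..b} \<times> UNIV)"
    and contL': "continuous_on ({a..b} \<times> UNIV) L'"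
    using assms(6) unfolding C1_on_def by blast
  have "continuous_on {a..b} (\<lambda>t. \<chi> i. y t $ i)"
    using y(1) by (intro continuous_on_vec_lambda abs_continuous_on_continuous_on) (simp add: D_space_def)
  then have cont_y: "continuous_on {a..b} y" by simp
  have cont_v: "continuous_on {a..b} v"
    using y(1) by (simp add: D_space_def v_def)
  define q where "q t = (y t, v t)" for t
  have cont_q: "continuous_on {a..b} q"
    unfolding q_def[abs_def] by (intro continuous_on_Pair cont_y cont_v)
  have contL'q: "continuous_on {a..b} (\<lambda>t. L' (t, q t))"
    by (rule continuous_on_compose2[OF contL']) (auto intro!: continuous_on_Pair continuous_on_id cont_q)
  \<comment> \<open>The partial derivatives of \<open>L\<close> along \<open>y\<close> in the
    \<open>l\<close>th state and the \<open>l\<close>th fractional derivative argument, read off the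
    total derivative.\<close>
  define \<psi> where "\<psi> t = blinfun_apply (L' (t, q t)) (0, u, 0)" for t
  define \<phi> where "\<phi> t = blinfun_apply (L' (t, q t)) (0, 0, u)" for t
  have cont_\<psi>: "continuous_on {a..b} \<psi>" and cont_\<phi>: "continuous_on {a..b} \<phi>"
    unfolding \<psi>_def[abs_def] \<phi>_def[abs_def] by (intro blinfun.continuous_on contL'q continuous_on_const)+
  define V where "V c = integral {a..b} (\<lambda>t. ramp c t * \<psi> t + R c t * \<phi> t)" for c
  have V: "V c \<le> 0 \<and> (y b $ l < yb $ l \<longrightarrow> V c = 0)" if c: "a \<le> c" "c < b" for c
  proof -
    define w where "w t = (ramp c t *\<^sub>R u, R c t *\<^sub>R u)" for t
    define z where "z e = (\<lambda>x. y x + (e * ramp c x) *\<^sub>R axis l 1)" for e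
    define g where "g e = integral {a..b} (\<lambda>t. L (t, q t + e *\<^sub>R w t))" for e
    have z_D: "z e \<in> D_space a b \<alpha> \<beta> \<gamma>" for e
      unfolding z_def using D_space_add_ramp(2)[OF \<alpha> \<beta> c(1) _ y(1)] c(2) by simp
    have z_comb: "comb_caputo_vec a b \<alpha> \<beta> \<gamma> (z e) x = v x + (e * R c x) *\<^sub>R u" if "x \<in> {a..b}" for e x
      unfolding z_def v_def R_def u_def using D_space_add_ramp(1)[OF \<alpha> \<beta> c(1) _ y(1) that] c(2) by simp
    have "continuous_on {a..b} (R c)"
      unfolding R_def using \<alpha> \<beta> by (intro continuous_on_ramp_caputo) auto
    then have cont_w: "continuous_on {a..b} w"
      unfolding w_def[abs_def]
      by (intro continuous_on_Pair continuous_on_scaleR continuous_on_ramp continuous_on_const)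
    note g = has_real_derivative_integral_variation[OF L' contL' cont_q cont_w]
    have J: "J_functional a b \<alpha> \<beta> \<gamma> L (z e) = g e" for e
    proof -
      have "J_functional a b \<alpha> \<beta> \<gamma> L (z e) = (LINT t:{a..b}|lebesgue. L (t, q t + e *\<^sub>R w t))"
        unfolding J_functional_def
      proof (rule set_lebesgue_integral_cong)
        show "\<forall>t. t \<in> {a..b} \<longrightarrow> L (bracket a b \<alpha> \<beta> \<gamma> (z e) t) = L (t, q t + e *\<^sub>R w t)"
          by (simp add: bracket_def z_comb q_def w_def) (simp add: z_def u_def)
      qed simp
      also have "\<dots> = g e"
        unfolding g_def
        by (rule set_lebesgue_integral_eq_integral(2)[OF absolutely_integrable_continuous_real[OF g(2)]])
      finally show ?thesis .
    qed
    have "blinfun_apply (L' (t, q t)) (0, w t) = ramp c t * \<psi> t + R c t * \<phi> t" for t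
    proof -
      have "(0 :: real, w t) = ramp c t *\<^sub>R (0, u, 0) + R c t *\<^sub>R (0, 0, u)" by (simp add: w_def)
      then show ?thesis by (simp only: blinfun.add_right blinfun.scaleR_right \<psi>_def \<phi>_def real_scaleR_def)
    qed
    then have g': "(g has_real_derivative V c) (at 0)"
      using g(1) unfolding g_def[abs_def] V_def by simp
    obtain C where "C > 0" and C: "\<And>e. norm_1_inf \<nu> a b \<alpha> \<beta> \<gamma> (\<lambda>x. (e * ramp c x) *\<^sub>R axis l 1) \<le> \<bar>e\<bar> * C"
      using norm_1_inf_ramp_le[OF assms(5) ab \<alpha> \<beta> c(1)] c(2) by (metis less_imp_le)
    \<comment> \<open>The first condition is closeness to \<open>y\<close>, the second the
      constraint at b, where the ramp equals b - c. The value at a is kept because a \<le>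
      c.\<close>
    have g_min: "g 0 \<le> g e" if e: "\<bar>e\<bar> * C < \<delta>" "y b $ l + e * (b - c) \<le> yb $ l" for e
    proof -
      have "J_functional a b \<alpha> \<beta> \<gamma> L y \<le> J_functional a b \<alpha> \<beta> \<gamma> L (z e)"
      proof (rule min[OF z_D])
        show "z e a = ya" using c y(2) by (simp add: z_def ramp_def)
        show "\<forall>i. i \<noteq> l \<longrightarrow> z e b $ i = yb $ i" using y(3) by (simp add: z_def axis_def)
        show "z e b $ l \<le> yb $ l" using e(2) c by (simp add: z_def ramp_def)
        show "norm_1_inf \<nu> a b \<alpha> \<beta> \<gamma> (\<lambda>x. z e x - y x) < \<delta>"
          using le_less_trans[OF C e(1)] by (simp add: z_def)
      qed
      moreover have "z 0 = y" by (simp add: z_def)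
      ultimately show ?thesis using J[of 0] J[of e] by simp
    qed
    have "V c \<le> 0"
    proof (rule ccontr)
      assume "\<not> V c \<le> 0"
      then obtain d where "d > 0" and d: "\<And>h. h > 0 \<Longrightarrow> h < d \<Longrightarrow> g (0 - h) < g 0"
        using DERIV_pos_inc_left[OF g'] by auto
      define h where "h = min (d / 2) (\<delta> / (2 * C))"
      have h: "h > 0" "h < d" "h * C < \<delta>"
        using \<open>d > 0\<close> \<open>\<delta> > 0\<close> \<open>C > 0\<close> by (auto simp: h_def min_def field_simps)
      have "0 \<le> h * (b - c)" using h(1) c by simp
      then have "g 0 \<le> g (0 - h)" using h y(4) by (intro g_min) auto
      then show False using d h by force
    qed
    moreover have "V c \<ge> 0" if "y b $ l < yb $ l"
    proof (rule ccontr)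
      assume "\<not> V c \<ge> 0"
      then obtain d where "d > 0" and d: "\<And>h. h > 0 \<Longrightarrow> h < d \<Longrightarrow> g (0 + h) < g 0"
        using DERIV_neg_dec_right[OF g'] by auto
      \<comment> \<open>The entries keep \<open>h\<close> below \<open>d\<close>, keep
        \<open>h * C\<close> below \<open>\<delta>\<close>, and use at most the slack in the
        endpoint constraint; the halves make the first two strict.\<close>
      define h where "h = Min {d / 2, \<delta> / (2 * C), (yb $ l - y b $ l) / (b - c)}"
      have h: "h > 0" "h \<le> d / 2" "h \<le> \<delta> / (2 * C)" "h \<le> (yb $ l - y b $ l) / (b - c)"
        unfolding h_def using \<open>d > 0\<close> \<open>\<delta> > 0\<close> \<open>C > 0\<close> that c
        by (auto simp del: divide_le_eq_numeral1 le_divide_eq_numeral1 intro!: Min_le)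
      have "g 0 \<le> g (0 + h)"
      proof (rule g_min)
        have "h * (2 * C) \<le> \<delta>" using h(3) \<open>C > 0\<close> by (simp add: pos_le_divide_eq)
        then show "\<bar>0 + h\<bar> * C < \<delta>" using h(1) \<open>\<delta> > 0\<close> by simp
        show "y b $ l + (0 + h) * (b - c) \<le> yb $ l" using h(4) c by (simp add: pos_le_divide_eq)
      qed
      then show False using d[of h] h \<open>d > 0\<close> by simp
    qed
    ultimately show ?thesis by force
  qed
  \<comment> \<open>With \<open>Suc n\<close> the sequence starts at c 0 = a, so every
    \<open>c n\<close> lies in [a, b).\<close>
  define c where "c n = b - (b - a) / real (Suc n)" for n
  have c: "a \<le> c n" "c n < b" for n
    using ab mult_right_mono[of a b "real n"] by (auto simp: c_def field_simps)
  have "c \<longlonglongrightarrow> b - 0"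
    unfolding c_def[abs_def] by (intro tendsto_diff tendsto_const LIMSEQ_Suc lim_const_over_n)
  then have lim: "(\<lambda>n. V (c n) / (b - c n)) \<longlonglongrightarrow> - (1 - \<gamma> $ l) * RL_int_left a (1 - \<beta> $ l) \<phi> b"
    unfolding V_def R_def using ab \<alpha> \<beta> \<gamma> c cont_\<psi> cont_\<phi> by (intro tendsto_ramp_variation) auto
  have "RL_int_left a (1 - \<beta> $ l) (\<lambda>x. partial_frac l L (bracket a b \<alpha> \<beta> \<gamma> y x)) b =
      RL_int_left a (1 - \<beta> $ l) \<phi> b"
    by (rule RL_int_left_cong) (simp add: bracket_def partial_frac_eq[OF L'] \<phi>_def q_def v_def u_def)
  then have "\<Lambda> = - (1 - \<gamma> $ l) * RL_int_left a (1 - \<beta> $ l) \<phi> b"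
    using assms(8) by (simp add: RL_int_right_endpoint algebra_simps)
  with lim have lim: "(\<lambda>n. V (c n) / (b - c n)) \<longlonglongrightarrow> \<Lambda>" by simp
  have "\<Lambda> \<le> 0"
    using lim by (rule tendsto_upperbound) (use V c in \<open>auto simp: divide_nonpos_pos\<close>)
  moreover have "\<Lambda> = 0" if "y b $ l < yb $ l"
  proof -
    have "V (c n) = 0" for n using V c that by blast
    then show ?thesis using lim LIMSEQ_unique[OF _ tendsto_const] by auto
  qed
  ultimately show ?thesis using y(4) by (cases "y b $ l = yb $ l") auto
qed

end
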